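(* Among non-caterpillar finite trees $T$ with $\lambda_{\max}(R_T)=0$, the only example (up to isomorphism) is $S_3^2$. Every finite tree $T$ that properly contains $S_3^2$ as a connected subtree has $\lambda_{\max}(R_T)>0$. Among caterpillars, the zero level set $\{T:\lambda_{\max}(R_T)=0\}$ consists exactly of the trees $T_m(3,0,\ldots,0,3)$, $m\ge 2$ (obtained by subdividing the central edge of the double star $T_2(3,3)$), together with the trees $T_m(a)$ where, up to reversal, $a$ is one of: $(2,5)$ ($m=2$); $(1,4,1)$, $(1,0,9)$ ($m=3$); $(1,0,0,6)$ ($m=4$); $(2,0,0,0,4)$, $(1,0,0,0,5)$ ($m=5$); $(1,0,0,0,0,0,0,4)$ ($m=8$); $(1,1,0,0,0,0,0,0,2)$ ($m=9$); $(1,0,0,0,0,0,0,0,0,0,1,1)$ ($m=12$).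
   Context: Trees are simple, connected, undirected, finite, with at least one edge. For a tree $T=(V,E)$, $d_v$ is the degree of $v\in V$; a leaf is a vertex of degree one. **Ricci matrix.** For a finite tree $T=(V,E)$ the Ricci matrix $R_T\in\mathbb R^{E\times E}$ is the real symmetric matrix with $(R_T)_{e,e}=-\left(\frac1{d_x}+\frac1{d_y}\right)$ for $e=\{x,y\}$, and, for distinct edges $e\ne f$, $(R_T)_{e,f}=1/d_z$ if $e\cap f=\{z\}$ and $(R_T)_{e,f}=0$ if $e\cap f=\varnothing$. $\lambda_{\max}(R_T)$ is its largest eigenvalue. **Caterpillars.** For $m\ge1$ and $a=(a_1,\dots,a_m)$ with integers $a_i\ge0$ and $a_1,a_m\ge1$, $T_m(a)$ is the tree consisting of a path $v_1,\dots,v_m$ (the spine, of order $m$) with $a_i$ additional leaves attached to $v_i$ for each $i$. For $m=1$ this is the star with $a_1$ edges. A caterpillar is a tree isomorphic to some $T_m(a)$; equivalently, a tree (with at least one edge) for which removing all leaves leaves a path, $K_2$ being included as a degenerate case. Reversing $a$ gives an isomorphic tree. $S_3^2$ is the tree obtained from the star with three edges by subdividing each edge once (seven vertices, six edges). *)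

theory Defs
  imports Complex_Main
begin

datatype 'a graph = Graph (verts: "'a set") (edges: "'a set set")

definition simple_graph :: "'a graph \<Rightarrow> bool" where
  "simple_graph G \<longleftrightarrow> (\<forall>e\<in>edges G. e \<subseteq> verts G \<and> card e = 2)"

definition graph_connected :: "'a graph \<Rightarrow> bool" where
  "graph_connected G \<longleftrightarrow>
     verts G \<noteq> {} \<and> (\<forall>x\<in>verts G. \<forall>y\<in>verts G. (\<lambda>u v. {u, v} \<in> edges G)\<^sup>*\<^sup>* x y)"

definition is_cycle :: "'a graph \<Rightarrow> 'a list \<Rightarrow> bool" where
  "is_cycle G xs \<longleftrightarrow> length xs \<ge> 3 \<and> distinct xs \<and>
     (\<forall>i<length xs. {xs ! i, xs ! (Suc i mod length xs)} \<in> edges G)"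

definition is_tree :: "'a graph \<Rightarrow> bool" where
  "is_tree G \<longleftrightarrow> simple_graph G \<and> finite (verts G) \<and> edges G \<noteq> {} \<and>
     graph_connected G \<and> (\<nexists>xs. is_cycle G xs)"

definition subgraph_of :: "'a graph \<Rightarrow> 'a graph \<Rightarrow> bool" where
  "subgraph_of H G \<longleftrightarrow> verts H \<subseteq> verts G \<and> edges H \<subseteq> edges G"

definition graph_isomorphic :: "'a graph \<Rightarrow> 'b graph \<Rightarrow> bool" where
  "graph_isomorphic G H \<longleftrightarrow> (\<exists>\<phi>. bij_betw \<phi> (verts G) (verts H) \<and>
     (\<forall>x\<in>verts G. \<forall>y\<in>verts G. {x, y} \<in> edges G \<longleftrightarrow> {\<phi> x, \<phi> y} \<in> edges H))"

definition vertex_degree :: "'a graph \<Rightarrow> 'a \<Rightarrow> nat" where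
  "vertex_degree G v = card {e \<in> edges G. v \<in> e}"


text \<open>Distinct edges of a simple graph share at most one vertex, so the second sum below is
  \<open>1 / d\<^sub>z\<close> if \<open>e \<inter> f = {z}\<close> and \<open>0\<close> if \<open>e \<inter> f = {}\<close>.\<close>

definition ricci_matrix :: "'a graph \<Rightarrow> 'a set \<Rightarrow> 'a set \<Rightarrow> real" where
  "ricci_matrix G e f =
     (if e = f then - (\<Sum>x\<in>e. 1 / real (vertex_degree G x))
      else (\<Sum>z\<in>e \<inter> f. 1 / real (vertex_degree G z)))"

text \<open>A real matrix with rows and columns indexed by a finite set \<open>I\<close> is a function
  \<open>A\<close> of which only the values on \<open>I \<times> I\<close> matter.\<close>

definition eigenvalue_on :: "'i set \<Rightarrow> ('i \<Rightarrow> 'i \<Rightarrow> real) \<Rightarrow> real \<Rightarrow> bool" where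
  "eigenvalue_on I A \<mu> \<longleftrightarrow>
     (\<exists>x. (\<exists>i\<in>I. x i \<noteq> 0) \<and> (\<forall>i\<in>I. (\<Sum>j\<in>I. A i j * x j) = \<mu> * x i))"

text \<open>The maximum is meaningful for finite nonempty \<open>I\<close> and symmetric \<open>A\<close>: the set of real
  eigenvalues is then finite and nonempty.\<close>

definition lambda_max_on :: "'i set \<Rightarrow> ('i \<Rightarrow> 'i \<Rightarrow> real) \<Rightarrow> real" where
  "lambda_max_on I A = Max {\<mu>. eigenvalue_on I A \<mu>}"

abbreviation ricci_lambda_max :: "'a graph \<Rightarrow> real" where
  "ricci_lambda_max G \<equiv> lambda_max_on (edges G) (ricci_matrix G)"


text \<open>The tree \<open>T\<^sub>m(a)\<close> with \<open>m = length a\<close>. Indices start at \<open>0\<close>: the spine vertex \<open>v\<^sub>i\<^sub>+\<^sub>1\<close> is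
  \<open>(i, 0)\<close>, and the leaves attached to it are \<open>(i, 1), \<dots>, (i, a ! i)\<close>.\<close>

definition caterpillar_tree :: "nat list \<Rightarrow> (nat \<times> nat) graph" where
  "caterpillar_tree a = Graph
     {(i, j) | i j. i < length a \<and> j \<le> a ! i}
     ({{(i, 0), (Suc i, 0)} | i. Suc i < length a} \<union>
      {{(i, 0), (i, j)} | i j. i < length a \<and> 1 \<le> j \<and> j \<le> a ! i})"

definition is_caterpillar :: "'a graph \<Rightarrow> bool" where
  "is_caterpillar T \<longleftrightarrow> is_tree T \<and>
     (\<exists>a. a \<noteq> [] \<and> hd a \<ge> 1 \<and> last a \<ge> 1 \<and> graph_isomorphic T (caterpillar_tree a))"

text \<open>\<open>S\<^sub>3\<^sup>2\<close>: centre \<open>0\<close>, subdivision vertices \<open>1, 2, 3\<close>, leaves \<open>4, 5, 6\<close>.\<close>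

definition S32 :: "nat graph" where
  "S32 = Graph {0, 1, 2, 3, 4, 5, 6} {{0, 1}, {0, 2}, {0, 3}, {1, 4}, {2, 5}, {3, 6}}"

definition properly_contains :: "'a graph \<Rightarrow> 'b graph \<Rightarrow> bool" where
  "properly_contains T S \<longleftrightarrow>
     (\<exists>H. is_tree H \<and> subgraph_of H T \<and> H \<noteq> T \<and> graph_isomorphic H S)"

definition sporadic_sequences :: "nat list set" where
  "sporadic_sequences =
     {[2, 5],
      [1, 4, 1],
      [1, 0, 9],
      [1, 0, 0, 6],
      [2, 0, 0, 0, 4],
      [1, 0, 0, 0, 5],
      [1, 0, 0, 0, 0, 0, 0, 4],
      [1, 1, 0, 0, 0, 0, 0, 0, 2],
      [1, 0, 0, 0, 0, 0, 0, 0, 0, 0, 1, 1]}"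

end

(* By Perron-Frobenius, lambda_max(R_T) = 0 holds for a tree iff R_T has a positive null vector.
   Attach a leaf at a vertex v of degree d, let S and q be the sums of x_e and of x_e^2 over the
   edges e at v, and give the new edge the value S / (d + 2). Then the quadratic form
   Q(x) = sum_v (S_v^2 - 2 q_v) / d_v grows by 2 (q - S^2 / (d + 2)) / (d (d + 1)), which is positive
   by Cauchy-Schwarz. Hence lambda_max > 0 for every tree properly containing a tree with a positive
   null vector, such as S_3^2. A tree in which no vertex has three non-leaf neighbours is a
   caterpillar, so every other tree contains S_3^2.

   For a caterpillar, the leaf edges can be eliminated, which leaves a linear recurrence along the
   spine. The load that the part to the left of a spine edge exerts on that edge is either
   nonnegative or -1/n times the value on the edge, with n an odd integer determined by a bare end
   with one or two leaves. Balancing the two loads at a spine vertex carrying leaves, or those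
   of the two ends if there is no such vertex, gives Diophantine equations with few solutions. *)
theory Submission
  imports Defs "HOL-Analysis.Function_Topology" "HOL-Analysis.Convex"
begin

section \<open>Symmetric matrices indexed by finite sets\<close>

text \<open>\<open>lambda_max_on\<close> is a \<open>Max\<close> over a set of reals, so it carries
  no information until that set is known to be finite and nonempty; this is why variational theory
  over an arbitrary finite index set comes first. Positivity of the null vector then turns the
  eigenvalue question into sign conditions that can be followed along a spine. On a stretch of the
  spine without leaves the load is constant and the edge value drops by twice the load at each step.
  A negative load \<open>- s / n\<close> therefore becomes \<open>- s / (n + 2)\<close>, and since
  an end with one leaf starts at n = 3 and an end with two leaves at n = 9, n stays odd. An end with
  three leaves exerts no load, hence the infinite family. A vertex with leaves inside the spine
  turns even the worst load \<open>- s / 3\<close> into a nonnegative one, so in a solution both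
  sides of such a vertex are bare and there is at most one of them. Parity then matters: with one
  leaf n = n' = 6, and with two leaves n = n' = 4, would also balance.\<close>

definition quad_form_on :: "'i set \<Rightarrow> ('i \<Rightarrow> 'i \<Rightarrow> real) \<Rightarrow> ('i \<Rightarrow> real) \<Rightarrow> real" where
  "quad_form_on I A x = (\<Sum>i\<in>I. x i * (\<Sum>j\<in>I. A i j * x j))"

lemma bilinear_sum_commute:
  fixes A :: "'i \<Rightarrow> 'i \<Rightarrow> real"
  assumes "\<And>i j. i \<in> I \<Longrightarrow> j \<in> I \<Longrightarrow> A i j = A j i"
  shows "(\<Sum>i\<in>I. x i * (\<Sum>j\<in>I. A i j * y j)) = (\<Sum>i\<in>I. y i * (\<Sum>j\<in>I. A i j * x j))"
proof -
  have "(\<Sum>i\<in>I. x i * (\<Sum>j\<in>I. A i j * y j)) = (\<Sum>i\<in>I. \<Sum>j\<in>I. y j * (A j i * x i))"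
    unfolding sum_distrib_left by (intro sum.cong refl) (simp add: assms)
  also have "\<dots> = (\<Sum>j\<in>I. \<Sum>i\<in>I. y j * (A j i * x i))"
    by (rule sum.swap)
  finally show ?thesis
    by (simp add: sum_distrib_left)
qed

text \<open>Vectors are functions on the whole index type, so the coordinates outside
  \<open>I\<close> are pinned to 0. The sphere is then a closed subset of a product of intervals and
  singletons, which is compact by Tychonoff's theorem.\<close>

lemma compact_unit_sphere_on:
  fixes I :: "'i set"
  assumes "finite I"
  shows "compact {x :: 'i \<Rightarrow> real. (\<forall>i. i \<notin> I \<longrightarrow> x i = 0) \<and> (\<Sum>i\<in>I. (x i)\<^sup>2) = 1}"
    (is "compact ?K")
proof -
  let ?B = "PiE UNIV (\<lambda>i. if i \<in> I then {-1..1} else {0::real})"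
  have "compactin (product_topology (\<lambda>i. euclidean) UNIV) ?B"
    by (subst compactin_PiE) auto
  then have B: "compact ?B"
    by (simp add: euclidean_product_topology)
  have C: "closed {x :: 'i \<Rightarrow> real. (\<Sum>i\<in>I. (x i)\<^sup>2) = 1}"
    by (intro closed_Collect_eq continuous_intros continuous_on_product_coordinates)
  have "?K = ?B \<inter> {x. (\<Sum>i\<in>I. (x i)\<^sup>2) = 1}"
  proof (intro equalityI subsetI)
    fix x assume x: "x \<in> ?K"
    have "x i \<in> {-1..1}" if "i \<in> I" for i
    proof -
      have "(x i)\<^sup>2 \<le> (\<Sum>i\<in>I. (x i)\<^sup>2)"
        using assms that by (intro member_le_sum) auto
      then have "(x i)\<^sup>2 \<le> 1"
        using x by simp
      then show ?thesis
        by (simp add: abs_square_le_1 abs_le_iff)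
    qed
    with x show "x \<in> ?B \<inter> {x. (\<Sum>i\<in>I. (x i)\<^sup>2) = 1}"
      by auto
  next
    fix x assume "x \<in> ?B \<inter> {x. (\<Sum>i\<in>I. (x i)\<^sup>2) = 1}"
    then show "x \<in> ?K"
      by (auto simp: PiE_iff split: if_splits)
  qed
  then show ?thesis
    using compact_Int_closed[OF B C] by simp
qed

lemma quad_form_on_add_single:
  fixes A :: "'i \<Rightarrow> 'i \<Rightarrow> real"
  assumes "finite I" "k \<in> I" and sym: "\<And>i j. i \<in> I \<Longrightarrow> j \<in> I \<Longrightarrow> A i j = A j i"
  shows "quad_form_on I A (\<lambda>i. x i + (if i = k then t else 0)) =
    quad_form_on I A x + 2 * t * (\<Sum>j\<in>I. A k j * x j) + t\<^sup>2 * A k k"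
proof -
  let ?d = "\<lambda>i. if i = k then t else 0"
  have d: "(\<Sum>j\<in>I. f j * ?d j) = f k * t" "(\<Sum>j\<in>I. ?d j * f j) = t * f k" for f :: "'i \<Rightarrow> real"
    using assms(1,2) by (simp_all add: if_distrib if_distribR sum.delta cong: if_cong)
  have "quad_form_on I A (\<lambda>i. x i + ?d i) = quad_form_on I A x +
      (\<Sum>i\<in>I. x i * (\<Sum>j\<in>I. A i j * ?d j)) + (\<Sum>i\<in>I. ?d i * (\<Sum>j\<in>I. A i j * x j))
      + (\<Sum>i\<in>I. ?d i * (\<Sum>j\<in>I. A i j * ?d j))"
    unfolding quad_form_on_def by (simp only: distrib_left distrib_right sum.distrib add.assoc)
  also have "(\<Sum>i\<in>I. x i * (\<Sum>j\<in>I. A i j * ?d j)) = (\<Sum>i\<in>I. ?d i * (\<Sum>j\<in>I. A i j * x j))"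
    by (rule bilinear_sum_commute) (rule sym)
  finally show ?thesis
    by (simp only: d) (simp add: power2_eq_square)
qed

lemma sum_power2_add_single:
  fixes x :: "'i \<Rightarrow> real"
  assumes "finite I" "k \<in> I"
  shows "(\<Sum>i\<in>I. (x i + (if i = k then t else 0))\<^sup>2) = (\<Sum>i\<in>I. (x i)\<^sup>2) + 2 * t * x k + t\<^sup>2"
proof -
  have "(\<Sum>i\<in>I. (x i + (if i = k then t else 0))\<^sup>2)
      = (\<Sum>i\<in>I. (x i)\<^sup>2 + (if i = k then 2 * t * x k + t\<^sup>2 else 0))"
    by (intro sum.cong) (auto simp: power2_eq_square algebra_simps)
  then show ?thesis
    using assms by (simp add: sum.distrib)
qed

lemma linear_part_eq_0:
  fixes b c :: real
  assumes "\<And>t. 2 * t * b + t\<^sup>2 * c \<le> 0"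
  shows "b = 0"
proof (rule ccontr)
  assume b: "b \<noteq> 0"
  \<comment> \<open>The test value is \<open>t = k * b\<close>. This \<open>k\<close> keeps
    \<open>k * c\<close> below 1 in absolute value, so the linear part decides the sign.\<close>
  define k where "k = 1 / (\<bar>c\<bar> + 1)"
  have k: "k > 0" "k * \<bar>c\<bar> < 1"
    unfolding k_def by (auto simp: divide_simps)
  have "2 * (k * b) * b + (k * b)\<^sup>2 * c \<le> 0"
    by (rule assms)
  then have "(k * b\<^sup>2) * (2 + k * c) \<le> 0"
    by (simp add: power2_eq_square algebra_simps)
  moreover have "k * b\<^sup>2 > 0"
    using b k by simp
  moreover have "\<bar>k * c\<bar> < 1"
    using k by (simp add: abs_mult)
  then have "2 + k * c > 0"
    by linarith
  ultimately show False
    by (smt (verit) mult_pos_pos)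
qed

text \<open>First variation: moving the single coordinate \<open>k\<close> of a maximizer by
  \<open>t\<close> changes the form minus \<open>M\<close> times the squared norm by a quadratic in
  \<open>t\<close> without constant term. It never exceeds 0, so its linear coefficient
  vanishes.\<close>

lemma quad_form_on_maximizer_eigenvector:
  fixes A :: "'i \<Rightarrow> 'i \<Rightarrow> real"
  assumes fin: "finite I" and sym: "\<And>i j. i \<in> I \<Longrightarrow> j \<in> I \<Longrightarrow> A i j = A j i"
    and le: "\<And>x. quad_form_on I A x \<le> M * (\<Sum>i\<in>I. (x i)\<^sup>2)"
    and ge: "quad_form_on I A y \<ge> M * (\<Sum>i\<in>I. (y i)\<^sup>2)"
    and k: "k \<in> I"
  shows "(\<Sum>j\<in>I. A k j * y j) = M * y k"
proof -
  have "2 * t * ((\<Sum>j\<in>I. A k j * y j) - M * y k) + t\<^sup>2 * (A k k - M) \<le> 0" for t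
    using le[of "\<lambda>i. y i + (if i = k then t else 0)"] ge
    unfolding quad_form_on_add_single[where A = A, OF fin k sym, simplified] sum_power2_add_single[OF fin k]
    by (simp add: algebra_simps)
  then show ?thesis
    using linear_part_eq_0 by fastforce
qed

lemma symmetric_max_eigenvalue_exists:
  fixes A :: "'i \<Rightarrow> 'i \<Rightarrow> real"
  assumes fin: "finite I" and ne: "I \<noteq> {}" and sym: "\<And>i j. i \<in> I \<Longrightarrow> j \<in> I \<Longrightarrow> A i j = A j i"
  obtains M where "eigenvalue_on I A M"
    and "\<And>x. quad_form_on I A x \<le> M * (\<Sum>i\<in>I. (x i)\<^sup>2)"
proof -
  define K where "K = {x :: 'i \<Rightarrow> real. (\<forall>i. i \<notin> I \<longrightarrow> x i = 0) \<and> (\<Sum>i\<in>I. (x i)\<^sup>2) = 1}"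
  obtain i0 where i0: "i0 \<in> I"
    using ne by blast
  have "(\<lambda>i. if i = i0 then 1 else 0) \<in> K"
    using sum_power2_add_single[OF fin i0, of "\<lambda>_. 0" 1] i0 by (simp add: K_def)
  then have "K \<noteq> {}"
    by blast
  moreover have "continuous_on K (\<lambda>x. x i)" for i
    by (rule continuous_on_subset[OF continuous_on_product_coordinates]) simp
  then have "continuous_on K (quad_form_on I A)"
    unfolding quad_form_on_def[abs_def] by (intro continuous_intros)
  ultimately obtain y where y: "y \<in> K"
    and max: "\<And>x. x \<in> K \<Longrightarrow> quad_form_on I A x \<le> quad_form_on I A y"
    using continuous_attains_sup[OF compact_unit_sphere_on[OF fin], folded K_def] by blast
  define M where "M = quad_form_on I A y"
  have le: "quad_form_on I A x \<le> M * (\<Sum>i\<in>I. (x i)\<^sup>2)" for x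
  proof (cases "(\<Sum>i\<in>I. (x i)\<^sup>2) = 0")
    case True
    then have "\<And>i. i \<in> I \<Longrightarrow> x i = 0"
      using fin by (simp add: sum_nonneg_eq_0_iff)
    then show ?thesis
      by (simp add: quad_form_on_def)
  next
    case False
    define r where "r = sqrt (\<Sum>i\<in>I. (x i)\<^sup>2)"
    have r2: "r\<^sup>2 = (\<Sum>i\<in>I. (x i)\<^sup>2)"
      unfolding r_def by (simp add: sum_nonneg)
    with False have r: "r \<noteq> 0"
      by auto
    \<comment> \<open>Rescaling to norm 1 does not yet land in \<open>K\<close>; the values outside
      \<open>I\<close> are set to 0 as well.\<close>
    let ?z = "\<lambda>i. if i \<in> I then x i / r else 0"
    have "(\<Sum>i\<in>I. (?z i)\<^sup>2) = (\<Sum>i\<in>I. (x i)\<^sup>2) / r\<^sup>2"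
      by (simp add: power_divide sum_divide_distrib)
    with r r2 False have "?z \<in> K"
      by (simp add: K_def)
    then have "quad_form_on I A ?z \<le> M"
      unfolding M_def by (rule max)
    moreover have "quad_form_on I A ?z = quad_form_on I A x / r\<^sup>2"
    proof -
      have z: "(\<Sum>j\<in>I. A i j * ?z j) = (\<Sum>j\<in>I. A i j * x j) / r" for i
        by (simp add: sum_divide_distrib)
      show ?thesis
        unfolding quad_form_on_def z sum_divide_distrib[of _ _ "r\<^sup>2"]
        by (intro sum.cong refl) (simp add: power2_eq_square)
    qed
    ultimately show ?thesis
      using r by (simp add: pos_divide_le_eq flip: r2)
  qed
  have "(\<Sum>j\<in>I. A k j * y j) = M * y k" if "k \<in> I" for k
    by (rule quad_form_on_maximizer_eigenvector[OF fin sym le _ that]) (use y in \<open>auto simp: M_def K_def\<close>)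
  moreover have "\<exists>i\<in>I. y i \<noteq> 0"
  proof (rule ccontr)
    assume "\<not> (\<exists>i\<in>I. y i \<noteq> 0)"
    then have "(\<Sum>i\<in>I. (y i)\<^sup>2) = 0"
      by (intro sum.neutral) auto
    with y show False
      by (simp add: K_def)
  qed
  ultimately have "eigenvalue_on I A M"
    unfolding eigenvalue_on_def by blast
  with le that show thesis
    by blast
qed

section \<open>Finiteness of the spectrum of a symmetric matrix\<close>

lemma eigenvector_orthogonal:
  fixes A :: "'i \<Rightarrow> 'i \<Rightarrow> real"
  assumes sym: "\<And>i j. i \<in> I \<Longrightarrow> j \<in> I \<Longrightarrow> A i j = A j i"
    and "\<And>i. i \<in> I \<Longrightarrow> (\<Sum>j\<in>I. A i j * x j) = \<mu> * x i"
    and "\<And>i. i \<in> I \<Longrightarrow> (\<Sum>j\<in>I. A i j * y j) = \<nu> * y i"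
    and "\<mu> \<noteq> \<nu>"
  shows "(\<Sum>i\<in>I. x i * y i) = 0"
proof -
  have "\<nu> * (\<Sum>i\<in>I. x i * y i) = (\<Sum>i\<in>I. x i * (\<Sum>j\<in>I. A i j * y j))"
    using assms(3) by (simp add: sum_distrib_left[of \<nu>] mult.left_commute cong: sum.cong)
  also have "\<dots> = (\<Sum>i\<in>I. y i * (\<Sum>j\<in>I. A i j * x j))"
    by (rule bilinear_sum_commute) (rule sym)
  also have "\<dots> = \<mu> * (\<Sum>i\<in>I. x i * y i)"
    using assms(2) by (simp add: sum_distrib_left[of \<mu>] mult_ac(2,3) cong: sum.cong)
  finally show ?thesis
    using \<open>\<mu> \<noteq> \<nu>\<close> by simp
qed

text \<open>Bessel's inequality for the coordinate vectors, summed over all coordinates.\<close>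

lemma card_orthonormal_le:
  fixes u :: "'k \<Rightarrow> 'i \<Rightarrow> real"
  assumes "finite I" "finite F"
    and on: "\<And>k l. k \<in> F \<Longrightarrow> l \<in> F \<Longrightarrow> (\<Sum>i\<in>I. u k i * u l i) = (if k = l then 1 else 0)"
  shows "card F \<le> card I"
proof -
  have bessel: "(\<Sum>k\<in>F. (u k i)\<^sup>2) \<le> 1" if i: "i \<in> I" for i
  proof -
    \<comment> \<open>\<open>?p\<close> is the orthogonal projection of the coordinate vector
      \<open>?d\<close> onto the span of the \<open>u k\<close>; the bound comes from expanding the
      squared norm of \<open>?d - ?p\<close>.\<close>
    let ?p = "\<lambda>j. \<Sum>k\<in>F. u k i * u k j"
    let ?d = "\<lambda>j. if j = i then 1 else 0"
    have "(\<Sum>j\<in>I. ?d j * ?p j) = (\<Sum>j\<in>I. if j = i then ?p j else 0)"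
      by (intro sum.cong) auto
    then have cross: "(\<Sum>j\<in>I. ?d j * ?p j) = (\<Sum>k\<in>F. (u k i)\<^sup>2)"
      using assms(1) i by (simp add: power2_eq_square)
    have "(\<Sum>j\<in>I. (?p j)\<^sup>2) = (\<Sum>j\<in>I. \<Sum>k\<in>F. \<Sum>l\<in>F. (u k i * u l i) * (u k j * u l j))"
      unfolding power2_eq_square sum_product by (intro sum.cong refl) (simp add: mult_ac)
    also have "\<dots> = (\<Sum>k\<in>F. \<Sum>j\<in>I. \<Sum>l\<in>F. (u k i * u l i) * (u k j * u l j))"
      by (rule sum.swap)
    also have "\<dots> = (\<Sum>k\<in>F. \<Sum>l\<in>F. (u k i * u l i) * (\<Sum>j\<in>I. u k j * u l j))"
      unfolding sum_distrib_left by (intro sum.cong refl sum.swap)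
    also have "\<dots> = (\<Sum>k\<in>F. (u k i)\<^sup>2)"
      using assms(2) by (intro sum.cong refl) (simp add: on power2_eq_square if_distrib cong: if_cong)
    finally have sq: "(\<Sum>j\<in>I. (?p j)\<^sup>2) = (\<Sum>k\<in>F. (u k i)\<^sup>2)" .
    have "0 \<le> (\<Sum>j\<in>I. (?d j - ?p j)\<^sup>2)"
      by (intro sum_nonneg) simp
    also have "\<dots> = (\<Sum>j\<in>I. ?d j - 2 * (?d j * ?p j) + (?p j)\<^sup>2)"
    proof (rule sum.cong[OF refl])
      have "(?d j - p)\<^sup>2 = ?d j - 2 * (?d j * p) + p\<^sup>2" for j and p :: real
        by (simp add: power2_eq_square algebra_simps)
      then show "(?d j - ?p j)\<^sup>2 = ?d j - 2 * (?d j * ?p j) + (?p j)\<^sup>2" for j .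
    qed
    also have "\<dots> = (\<Sum>j\<in>I. ?d j) - 2 * (\<Sum>j\<in>I. ?d j * ?p j) + (\<Sum>j\<in>I. (?p j)\<^sup>2)"
      by (simp only: sum.distrib sum_subtractf sum_distrib_left)
    also have "\<dots> = 1 - (\<Sum>k\<in>F. (u k i)\<^sup>2)"
      unfolding cross sq using assms(1) i by simp
    finally show ?thesis
      by simp
  qed
  have "real (card F) = (\<Sum>k\<in>F. \<Sum>i\<in>I. (u k i)\<^sup>2)"
    using on by (simp add: power2_eq_square)
  also have "\<dots> = (\<Sum>i\<in>I. \<Sum>k\<in>F. (u k i)\<^sup>2)"
    by (rule sum.swap)
  also have "\<dots> \<le> (\<Sum>i\<in>I. 1)"
    by (intro sum_mono bessel)
  finally show ?thesis
    by simp
qed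

text \<open>Normalized eigenvectors to distinct eigenvalues are orthonormal, and an orthonormal
  family has at most \<open>card I\<close> members.\<close>

lemma finite_eigenvalues_on:
  fixes A :: "'i \<Rightarrow> 'i \<Rightarrow> real"
  assumes fin: "finite I" and sym: "\<And>i j. i \<in> I \<Longrightarrow> j \<in> I \<Longrightarrow> A i j = A j i"
  shows "finite {\<mu>. eigenvalue_on I A \<mu>}"
proof (rule ccontr)
  assume "infinite {\<mu>. eigenvalue_on I A \<mu>}"
  then obtain F where F: "F \<subseteq> {\<mu>. eigenvalue_on I A \<mu>}" "finite F" "card F = Suc (card I)"
    using infinite_arbitrarily_large by blast
  then have "\<forall>\<mu>\<in>F. \<exists>x. (\<exists>i\<in>I. x i \<noteq> 0) \<and> (\<forall>i\<in>I. (\<Sum>j\<in>I. A i j * x j) = \<mu> * x i)"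
    by (auto simp: eigenvalue_on_def)
  then obtain w where w0: "\<And>\<mu>. \<mu> \<in> F \<Longrightarrow> \<exists>i\<in>I. w \<mu> i \<noteq> 0"
    and w: "\<And>\<mu> i. \<mu> \<in> F \<Longrightarrow> i \<in> I \<Longrightarrow> (\<Sum>j\<in>I. A i j * w \<mu> j) = \<mu> * w \<mu> i"
    by metis
  define r where "r \<mu> = sqrt (\<Sum>i\<in>I. (w \<mu> i)\<^sup>2)" for \<mu>
  have r2: "r \<mu> * r \<mu> = (\<Sum>i\<in>I. w \<mu> i * w \<mu> i)" for \<mu>
    unfolding r_def by (simp add: sum_nonneg power2_eq_square)
  have r: "r \<mu> \<noteq> 0" if "\<mu> \<in> F" for \<mu>
    using w0[OF that] fin unfolding r_def by (auto simp: sum_nonneg_eq_0_iff)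
  have "card F \<le> card I"
  proof (rule card_orthonormal_le[OF fin F(2), where u = "\<lambda>\<mu> i. w \<mu> i / r \<mu>"])
    fix \<mu> \<nu> assume *: "\<mu> \<in> F" "\<nu> \<in> F"
    have "(\<Sum>i\<in>I. w \<mu> i / r \<mu> * (w \<nu> i / r \<nu>)) = (\<Sum>i\<in>I. w \<mu> i * w \<nu> i) / (r \<mu> * r \<nu>)"
      by (simp add: sum_divide_distrib)
    moreover have "(\<Sum>i\<in>I. w \<mu> i * w \<nu> i) = 0" if "\<mu> \<noteq> \<nu>"
      by (rule eigenvector_orthogonal[where A = A, OF sym _ _ that]) (use w * in auto)
    ultimately show "(\<Sum>i\<in>I. w \<mu> i / r \<mu> * (w \<nu> i / r \<nu>)) = (if \<mu> = \<nu> then 1 else 0)"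
      using r[OF *(1)] by (auto simp flip: r2)
  qed
  with F(3) show False
    by simp
qed

lemma quad_form_on_eigenvector:
  assumes "\<And>i. i \<in> I \<Longrightarrow> (\<Sum>j\<in>I. A i j * x j) = \<mu> * x i"
  shows "quad_form_on I A x = \<mu> * (\<Sum>i\<in>I. (x i)\<^sup>2)"
  unfolding quad_form_on_def sum_distrib_left[of \<mu>]
  by (intro sum.cong refl) (simp add: assms power2_eq_square)

lemma sum_power2_pos:
  fixes x :: "'i \<Rightarrow> real"
  assumes "finite I" "\<exists>i\<in>I. x i \<noteq> 0"
  shows "(\<Sum>i\<in>I. (x i)\<^sup>2) > 0"
proof -
  obtain i where "i \<in> I" "x i \<noteq> 0"
    using assms(2) by blast
  then show ?thesis
    by (intro sum_pos2[OF assms(1)]) auto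
qed

section \<open>Rayleigh bound and nonnegative top eigenvectors\<close>

lemma lambda_max_on_rayleigh:
  fixes A :: "'i \<Rightarrow> 'i \<Rightarrow> real"
  assumes fin: "finite I" and ne: "I \<noteq> {}" and sym: "\<And>i j. i \<in> I \<Longrightarrow> j \<in> I \<Longrightarrow> A i j = A j i"
  shows "eigenvalue_on I A (lambda_max_on I A)"
    and "quad_form_on I A x \<le> lambda_max_on I A * (\<Sum>i\<in>I. (x i)\<^sup>2)"
proof -
  obtain M where M: "eigenvalue_on I A M"
    and le: "\<And>x. quad_form_on I A x \<le> M * (\<Sum>i\<in>I. (x i)\<^sup>2)"
    using symmetric_max_eigenvalue_exists[where A = A, OF fin ne sym] by metis
  \<comment> \<open>Evaluating the bound on the form at an eigenvector shows that \<open>M\<close>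
    dominates every eigenvalue; together with finiteness this identifies \<open>M\<close> as the
    \<open>Max\<close>.\<close>
  have "\<mu> \<le> M" if \<mu>: "eigenvalue_on I A \<mu>" for \<mu>
  proof -
    obtain x where x: "\<exists>i\<in>I. x i \<noteq> 0" "\<And>i. i \<in> I \<Longrightarrow> (\<Sum>j\<in>I. A i j * x j) = \<mu> * x i"
      using \<mu> by (auto simp: eigenvalue_on_def)
    then show ?thesis
      using le[of x] quad_form_on_eigenvector[of I A x \<mu>] sum_power2_pos[OF fin x(1)] by simp
  qed
  then have "lambda_max_on I A = M"
    unfolding lambda_max_on_def using M finite_eigenvalues_on[where A = A, OF fin sym]
    by (intro Max_eqI) auto
  with M le show "eigenvalue_on I A (lambda_max_on I A)"
    "quad_form_on I A x \<le> lambda_max_on I A * (\<Sum>i\<in>I. (x i)\<^sup>2)"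
    by simp_all
qed

text \<open>Taking absolute values keeps the norm and, as the off-diagonal entries are nonnegative,
  does not lower the quadratic form. So the absolute value of a top eigenvector is again a
  maximizer, hence an eigenvector.\<close>

lemma nonneg_max_eigenvector_exists:
  fixes A :: "'i \<Rightarrow> 'i \<Rightarrow> real"
  assumes fin: "finite I" and ne: "I \<noteq> {}" and sym: "\<And>i j. i \<in> I \<Longrightarrow> j \<in> I \<Longrightarrow> A i j = A j i"
    and nonneg: "\<And>i j. i \<in> I \<Longrightarrow> j \<in> I \<Longrightarrow> i \<noteq> j \<Longrightarrow> A i j \<ge> 0"
  obtains y where "\<And>i. y i \<ge> 0" "\<exists>i\<in>I. y i \<noteq> 0"
    "\<And>i. i \<in> I \<Longrightarrow> (\<Sum>j\<in>I. A i j * y j) = lambda_max_on I A * y i"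
proof -
  note R = lambda_max_on_rayleigh[where A = A, OF fin ne sym]
  obtain x where x: "\<exists>i\<in>I. x i \<noteq> 0" "\<And>i. i \<in> I \<Longrightarrow> (\<Sum>j\<in>I. A i j * x j) = lambda_max_on I A * x i"
    using R(1) by (auto simp: eigenvalue_on_def)
  have "A i j * (x i * x j) \<le> A i j * (\<bar>x i\<bar> * \<bar>x j\<bar>)" if "i \<in> I" "j \<in> I" for i j
  proof (cases "i = j")
    case False
    then show ?thesis
      using nonneg[OF that] by (intro mult_left_mono) (auto simp flip: abs_mult)
  qed simp
  then have "quad_form_on I A x \<le> quad_form_on I A (\<lambda>i. \<bar>x i\<bar>)"
    unfolding quad_form_on_def sum_distrib_left by (intro sum_mono) (simp add: mult_ac)
  then have "quad_form_on I A (\<lambda>i. \<bar>x i\<bar>) \<ge> lambda_max_on I A * (\<Sum>i\<in>I. (\<bar>x i\<bar>)\<^sup>2)"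
    using quad_form_on_eigenvector[of I A x, OF x(2)] by simp
  then have "(\<Sum>j\<in>I. A i j * \<bar>x j\<bar>) = lambda_max_on I A * \<bar>x i\<bar>" if "i \<in> I" for i
    using quad_form_on_maximizer_eigenvector[where A = A and y = "\<lambda>i. \<bar>x i\<bar>", OF fin sym R(2) _ that]
    by blast
  with x(1) show thesis
    by (intro that[of "\<lambda>i. \<bar>x i\<bar>"]) auto
qed

text \<open>If the largest eigenvalue were not 0, its nonnegative eigenvector would be orthogonal to
  the positive null vector, yet their inner product is positive.\<close>

lemma lambda_max_on_eq_0_if_pos_null_vector:
  fixes A :: "'i \<Rightarrow> 'i \<Rightarrow> real"
  assumes fin: "finite I" and ne: "I \<noteq> {}" and sym: "\<And>i j. i \<in> I \<Longrightarrow> j \<in> I \<Longrightarrow> A i j = A j i"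
    and nonneg: "\<And>i j. i \<in> I \<Longrightarrow> j \<in> I \<Longrightarrow> i \<noteq> j \<Longrightarrow> A i j \<ge> 0"
    and pos: "\<And>i. i \<in> I \<Longrightarrow> x i > 0"
    and null: "\<And>i. i \<in> I \<Longrightarrow> (\<Sum>j\<in>I. A i j * x j) = 0"
  shows "lambda_max_on I A = 0"
proof (rule ccontr)
  assume nz: "lambda_max_on I A \<noteq> 0"
  obtain y where y: "\<And>i. y i \<ge> 0" "\<exists>i\<in>I. y i \<noteq> 0"
    "\<And>i. i \<in> I \<Longrightarrow> (\<Sum>j\<in>I. A i j * y j) = lambda_max_on I A * y i"
    using nonneg_max_eigenvector_exists[where A = A, OF fin ne sym nonneg] by blast
  have "(\<Sum>i\<in>I. x i * y i) = 0"
    by (rule eigenvector_orthogonal[where A = A and \<mu> = 0 and \<nu> = "lambda_max_on I A"])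
      (use sym null y(3) nz in auto)
  moreover obtain k where "k \<in> I" "y k > 0"
    using y(1,2) by (metis less_eq_real_def)
  then have "(\<Sum>i\<in>I. x i * y i) > 0"
    using pos y(1) by (intro sum_pos2[OF fin]) (auto simp: less_imp_le)
  ultimately show False
    by simp
qed

section \<open>Paths and subtrees\<close>

lemma simple_graphE:
  assumes "simple_graph G" "e \<in> edges G"
  obtains u v where "e = {u, v}" "u \<noteq> v" "u \<in> verts G" "v \<in> verts G"
proof -
  have "e \<subseteq> verts G" "card e = 2"
    using assms by (auto simp: simple_graph_def)
  then obtain u v where "e = {u, v}" "u \<noteq> v"
    by (auto simp: card_2_iff)
  with \<open>e \<subseteq> verts G\<close> that show thesis
    by blast
qed

lemma simple_graph_edgeD:
  assumes "simple_graph G" "{u, v} \<in> edges G"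
  shows "u \<noteq> v" "u \<in> verts G" "v \<in> verts G"
proof -
  have "{u, v} \<subseteq> verts G" "card {u, v} = 2"
    using assms unfolding simple_graph_def by blast+
  then show "u \<noteq> v" "u \<in> verts G" "v \<in> verts G"
    by auto
qed

lemma finite_edges:
  assumes "simple_graph G" "finite (verts G)"
  shows "finite (edges G)"
  by (rule finite_subset[of _ "Pow (verts G)"]) (use assms in \<open>auto simp: simple_graph_def\<close>)

lemma finite_simple_edge: "simple_graph G \<Longrightarrow> e \<in> edges G \<Longrightarrow> finite e"
  by (auto simp: simple_graph_def intro: card_ge_0_finite)

lemma is_treeD:
  assumes "is_tree T"
  shows "simple_graph T" "finite (verts T)" "finite (edges T)" "edges T \<noteq> {}"
    "graph_connected T" "\<not> is_cycle T xs"
  using assms finite_edges[of T] by (auto simp: is_tree_def)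

definition graph_path :: "'a graph \<Rightarrow> 'a list \<Rightarrow> bool" where
  "graph_path G xs \<longleftrightarrow> xs \<noteq> [] \<and> distinct xs \<and> (\<forall>i. Suc i < length xs \<longrightarrow> {xs ! i, xs ! Suc i} \<in> edges G)"

lemma graph_path_single [simp]: "graph_path G [x]"
  by (simp add: graph_path_def)

lemma graph_path_Cons:
  assumes "graph_path G xs" "w \<notin> set xs" "{w, hd xs} \<in> edges G"
  shows "graph_path G (w # xs)"
  unfolding graph_path_def
proof (intro conjI allI impI)
  fix i assume i: "Suc i < length (w # xs)"
  show "{(w # xs) ! i, (w # xs) ! Suc i} \<in> edges G"
    using assms i by (cases i) (auto simp: graph_path_def hd_conv_nth)
qed (use assms in \<open>auto simp: graph_path_def\<close>)

lemma graph_path_rev: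
  assumes "graph_path G xs"
  shows "graph_path G (rev xs)"
  unfolding graph_path_def
proof (intro conjI allI impI)
  fix i assume i: "Suc i < length (rev xs)"
  then have "{xs ! (length xs - Suc (Suc i)), xs ! Suc (length xs - Suc (Suc i))} \<in> edges G"
    using assms unfolding graph_path_def by auto
  moreover have "Suc (length xs - Suc (Suc i)) = length xs - Suc i"
    using i by simp
  ultimately show "{rev xs ! i, rev xs ! Suc i} \<in> edges G"
    using i by (simp add: rev_nth insert_commute)
qed (use assms in \<open>auto simp: graph_path_def\<close>)

lemma graph_path_take:
  assumes "graph_path G xs" "n > 0"
  shows "graph_path G (take n xs)"
  using assms by (auto simp: graph_path_def)

lemma graph_path_drop:
  assumes "graph_path G xs" "n < length xs"
  shows "graph_path G (drop n xs)"
  using assms by (auto simp: graph_path_def)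

lemma graph_path_closing_edge_cycle:
  assumes "graph_path G xs" "length xs \<ge> 3" "{hd xs, last xs} \<in> edges G"
  shows "is_cycle G xs"
  unfolding is_cycle_def
proof (intro conjI allI impI)
  fix i assume i: "i < length xs"
  show "{xs ! i, xs ! (Suc i mod length xs)} \<in> edges G"
  proof (cases "Suc i = length xs")
    case True
    then have "last xs = xs ! i"
      by (metis diff_Suc_1 last_conv_nth length_0_conv nat.distinct(1))
    with True assms show ?thesis
      by (auto simp: graph_path_def hd_conv_nth insert_commute)
  next
    case False
    with i assms show ?thesis
      by (simp add: graph_path_def)
  qed
qed (use assms in \<open>auto simp: graph_path_def\<close>)

text \<open>Prepending a vertex to the path found so far might repeat it; in that case the path is
  cut back to start at its occurrence.\<close>

lemma connected_path_exists:
  assumes "(\<lambda>u v. {u, v} \<in> edges G)\<^sup>*\<^sup>* x y"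
  shows "\<exists>xs. graph_path G xs \<and> hd xs = x \<and> last xs = y"
  using assms
proof (induction rule: converse_rtranclp_induct)
  case base
  show ?case
    by (rule exI[of _ "[y]"]) simp
next
  case (step x z)
  then obtain xs where xs: "graph_path G xs" "hd xs = z" "last xs = y"
    by blast
  show ?case
  proof (cases "x \<in> set xs")
    case False
    with step xs have "graph_path G (x # xs)"
      by (intro graph_path_Cons) auto
    with xs show ?thesis
      by (intro exI[of _ "x # xs"]) (auto simp: graph_path_def)
  next
    case True
    then obtain i where i: "i < length xs" "xs ! i = x"
      by (auto simp: in_set_conv_nth)
    then have "graph_path G (drop i xs)" "hd (drop i xs) = x" "last (drop i xs) = y"
      using xs by (auto simp: graph_path_drop hd_drop_conv_nth)
    then show ?thesis
      by blast
  qed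
qed

text \<open>Paths in a tree are induced: an edge between two nonconsecutive positions would close
  the segment between them to a cycle.\<close>

lemma tree_path_edge:
  assumes T: "is_tree T" and p: "graph_path T p"
    and "i < j" "j < length p" "{p ! i, p ! j} \<in> edges T"
  shows "j = Suc i"
proof (rule ccontr)
  assume "j \<noteq> Suc i"
  define q where "q = drop i (take (Suc j) p)"
  have "graph_path T q"
    unfolding q_def using assms by (intro graph_path_drop graph_path_take) auto
  moreover have "length q \<ge> 3"
    using assms \<open>j \<noteq> Suc i\<close> by (simp add: q_def)
  moreover have "hd q = p ! i" "last q = p ! j"
    using assms by (simp_all add: q_def hd_drop_conv_nth take_Suc_conv_app_nth)
  ultimately show False
    using graph_path_closing_edge_cycle[of T q] is_treeD(6)[OF T] assms by simp
qed

text \<open>Two neighbours of \<open>w\<close> on the path, with the segment between them, would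
  form a cycle through \<open>w\<close>. This makes the spine position of a leaf well
  defined.\<close>

lemma tree_path_unique_attachment:
  assumes T: "is_tree T" and p: "graph_path T p" and w: "w \<notin> set p"
    and "i < length p" "j < length p" "{p ! i, w} \<in> edges T" "{p ! j, w} \<in> edges T"
  shows "i = j"
proof -
  have False if ij: "i < j" "j < length p" "{p ! i, w} \<in> edges T" "{p ! j, w} \<in> edges T" for i j
  proof -
    define q where "q = drop i (take (Suc j) p)"
    have q: "graph_path T q"
      unfolding q_def using p ij by (intro graph_path_drop graph_path_take) auto
    have len: "length q \<ge> 2"
      using ij by (simp add: q_def)
    have hl: "hd q = p ! i" "last q = p ! j"
      using ij by (simp_all add: q_def hd_drop_conv_nth take_Suc_conv_app_nth)
    have "set q \<subseteq> set p"
      unfolding q_def by (metis set_drop_subset set_take_subset subset_trans)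
    then have "graph_path T (w # q)"
      using w ij hl by (intro graph_path_Cons[OF q]) (auto simp: insert_commute)
    moreover have "{hd (w # q), last (w # q)} \<in> edges T"
      using len hl ij by (cases q) (auto simp: insert_commute)
    ultimately show False
      using graph_path_closing_edge_cycle[of T "w # q"] is_treeD(6)[OF T] len by simp
  qed
  then show ?thesis
    using assms by (metis nat_neq_iff)
qed

lemma is_cycle_subgraph: "subgraph_of H G \<Longrightarrow> is_cycle H xs \<Longrightarrow> is_cycle G xs"
  by (auto simp: is_cycle_def subgraph_of_def)

lemma connected_sym:
  "(\<lambda>u v. {u, v} \<in> edges G)\<^sup>*\<^sup>* x y \<Longrightarrow> (\<lambda>u v. {u, v} \<in> edges G)\<^sup>*\<^sup>* y x"
proof (induction rule: rtranclp_induct)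
  case (step y z)
  then have "{z, y} \<in> edges G"
    by (simp add: insert_commute)
  with step.IH show ?case
    by (intro converse_rtranclp_into_rtranclp[of _ z y])
qed simp

lemma connected_closed_set:
  assumes "graph_connected G" "x \<in> S" "x \<in> verts G"
    and closed: "\<And>u v. u \<in> S \<Longrightarrow> {u, v} \<in> edges G \<Longrightarrow> v \<in> S"
  shows "verts G \<subseteq> S"
proof
  fix y assume "y \<in> verts G"
  with assms have "(\<lambda>u v. {u, v} \<in> edges G)\<^sup>*\<^sup>* x y"
    by (auto simp: graph_connected_def)
  then show "y \<in> S"
    by (induction rule: rtranclp_induct) (use assms(2) closed in auto)
qed

lemma graph_connectedI:
  assumes "c \<in> verts G" "\<And>x. x \<in> verts G \<Longrightarrow> (\<lambda>u v. {u, v} \<in> edges G)\<^sup>*\<^sup>* c x"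
  shows "graph_connected G"
  unfolding graph_connected_def
proof (intro conjI ballI)
  fix x y assume "x \<in> verts G" "y \<in> verts G"
  then show "(\<lambda>u v. {u, v} \<in> edges G)\<^sup>*\<^sup>* x y"
    by (rule rtranclp_trans[OF connected_sym[OF assms(2)] assms(2)])
qed (use assms(1) in auto)

section \<open>Growing a subtree leaf by leaf\<close>

lemma spanning_subtree_eq:
  assumes T: "is_tree T" and H: "is_tree H" and sub: "subgraph_of H T" and "verts H = verts T"
  shows "H = T"
proof -
  have "e \<in> edges H" if e: "e \<in> edges T" for e
  proof (rule ccontr)
    assume ne: "e \<notin> edges H"
    obtain u v where uv: "e = {u, v}" "u \<noteq> v" "u \<in> verts T" "v \<in> verts T"
      using simple_graphE[OF is_treeD(1)[OF T] e] .
    then obtain p where p: "graph_path H p" "hd p = u" "last p = v"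
      using assms is_treeD(5)[OF H] connected_path_exists unfolding graph_connected_def by metis
    \<comment> \<open>A path with one vertex would give \<open>u = v\<close>, and one with two
      vertices would be the missing edge itself. So the path and \<open>e\<close> close to a cycle
      in \<open>T\<close>.\<close>
    have "length p \<ge> 3"
    proof (rule ccontr)
      assume "\<not> length p \<ge> 3"
      then consider "length p = 0" | "length p = 1" | "length p = 2"
        by linarith
      then show False
        using p uv ne by cases (auto simp: graph_path_def length_Suc_conv numeral_2_eq_2)
    qed
    moreover have "graph_path T p"
      using p(1) sub by (auto simp: graph_path_def subgraph_of_def)
    ultimately have "is_cycle T p"
      using p e uv by (intro graph_path_closing_edge_cycle) auto
    then show False
      using is_treeD(6)[OF T] by blast
  qed
  with assms show ?thesis
    by (cases H; cases T) (auto simp: subgraph_of_def)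
qed

definition add_leaf :: "'a graph \<Rightarrow> 'a \<Rightarrow> 'a \<Rightarrow> 'a graph" where
  "add_leaf G v w = Graph (insert w (verts G)) (insert {v, w} (edges G))"

lemma add_leaf_sel [simp]:
  "verts (add_leaf G v w) = insert w (verts G)"
  "edges (add_leaf G v w) = insert {v, w} (edges G)"
  by (simp_all add: add_leaf_def)

text \<open>Acyclicity is inherited from \<open>T\<close>, inside which the enlarged graph still
  lies; connectedness has to be extended to the new vertex.\<close>

lemma is_tree_add_leaf:
  assumes T: "is_tree T" and H: "is_tree H" and sub: "subgraph_of H T"
    and vw: "v \<in> verts H" "w \<in> verts T" "w \<notin> verts H" "{v, w} \<in> edges T"
  shows "is_tree (add_leaf H v w)" "subgraph_of (add_leaf H v w) T"
proof -
  let ?R = "\<lambda>G u v. {u, v} \<in> edges G"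
  show sub': "subgraph_of (add_leaf H v w) T"
    using sub vw by (auto simp: subgraph_of_def)
  have "graph_connected (add_leaf H v w)"
  proof (rule graph_connectedI[of v])
    fix x assume "x \<in> verts (add_leaf H v w)"
    then consider "x = w" | "x \<in> verts H"
      by auto
    then show "(?R (add_leaf H v w))\<^sup>*\<^sup>* v x"
    proof cases
      case 2
      then have "(?R H)\<^sup>*\<^sup>* v x"
        using is_treeD(5)[OF H] vw by (auto simp: graph_connected_def)
      then show ?thesis
        by (rule rtranclp_mono[THEN predicate2D, rotated]) auto
    qed (auto intro: r_into_rtranclp)
  qed (use vw in simp)
  moreover have "simple_graph (add_leaf H v w)"
    using is_treeD(1)[OF H] vw by (auto simp: simple_graph_def card_insert_if)
  ultimately show "is_tree (add_leaf H v w)"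
    using is_treeD(2)[OF H] is_cycle_subgraph[OF sub'] is_treeD(6)[OF T]
    unfolding is_tree_def by auto
qed

lemma proper_subtree_neighbour:
  assumes T: "is_tree T" and H: "is_tree H" and sub: "subgraph_of H T" and ne: "H \<noteq> T"
  obtains v w where "v \<in> verts H" "w \<in> verts T" "w \<notin> verts H" "{v, w} \<in> edges T"
proof -
  obtain x where x: "x \<in> verts H"
    using is_treeD(5)[OF H] by (auto simp: graph_connected_def)
  have "\<not> verts T \<subseteq> verts H"
    using spanning_subtree_eq[OF T H sub] ne sub by (auto simp: subgraph_of_def)
  then have "\<exists>u v. u \<in> verts H \<and> {u, v} \<in> edges T \<and> v \<notin> verts H"
    using connected_closed_set[OF is_treeD(5)[OF T] x] x sub by (auto simp: subgraph_of_def)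
  then show thesis
    using that simple_graph_edgeD[OF is_treeD(1)[OF T]] by blast
qed

section \<open>Isomorphisms of simple graphs\<close>

lemma graph_isomorphic_edges:
  assumes "simple_graph G" "simple_graph H" "bij_betw \<phi> (verts G) (verts H)"
    and iff: "\<And>x y. x \<in> verts G \<Longrightarrow> y \<in> verts G \<Longrightarrow> {x, y} \<in> edges G \<longleftrightarrow> {\<phi> x, \<phi> y} \<in> edges H"
  shows "edges H = (`) \<phi> ` edges G"
proof (intro equalityI subsetI)
  fix e assume e: "e \<in> edges H"
  then obtain a b where ab: "e = {a, b}" "a \<in> verts H" "b \<in> verts H"
    using simple_graphE[OF assms(2)] by metis
  then obtain x y where "x \<in> verts G" "y \<in> verts G" "a = \<phi> x" "b = \<phi> y"
    using assms(3) unfolding bij_betw_def by blast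
  with ab e iff[of x y] show "e \<in> (`) \<phi> ` edges G"
    by (intro image_eqI[of _ _ "{x, y}"]) auto
next
  fix e assume "e \<in> (`) \<phi> ` edges G"
  then obtain f where f: "f \<in> edges G" "e = \<phi> ` f"
    by blast
  then obtain x y where "f = {x, y}" "x \<in> verts G" "y \<in> verts G"
    using simple_graphE[OF assms(1)] by metis
  with f iff[of x y] show "e \<in> edges H"
    by simp
qed

lemma graph_isomorphicI:
  assumes "simple_graph G" "bij_betw \<phi> (verts G) (verts H)" "edges H = (`) \<phi> ` edges G"
  shows "graph_isomorphic G H"
proof -
  have "{x, y} \<in> edges G" if xy: "x \<in> verts G" "y \<in> verts G" and "{\<phi> x, \<phi> y} \<in> edges H" for x y
  proof -
    have "\<phi> ` {x, y} \<in> (`) \<phi> ` edges G"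
      using that assms(3) by simp
    then obtain f where f: "f \<in> edges G" "\<phi> ` {x, y} = \<phi> ` f"
      by (rule imageE) simp
    have "f \<subseteq> verts G"
      using f assms(1) by (auto simp: simple_graph_def)
    then have "f = {x, y}"
      using f xy assms(2) inj_on_image_eq_iff[of \<phi> "verts G" "{x, y}" f] by (auto simp: bij_betw_def)
    with f show ?thesis
      by simp
  qed
  moreover have "{\<phi> x, \<phi> y} \<in> edges H" if "{x, y} \<in> edges G" for x y
    using image_eqI[of _ "(`) \<phi>", OF _ that] assms(3) by auto
  ultimately show ?thesis
    unfolding graph_isomorphic_def using assms(2) by blast
qed

lemma graph_isomorphic_sym:
  assumes "graph_isomorphic G H"
  shows "graph_isomorphic H G"
proof -
  obtain \<phi> where \<phi>: "bij_betw \<phi> (verts G) (verts H)"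
    "\<And>x y. x \<in> verts G \<Longrightarrow> y \<in> verts G \<Longrightarrow> {x, y} \<in> edges G \<longleftrightarrow> {\<phi> x, \<phi> y} \<in> edges H"
    using assms unfolding graph_isomorphic_def by blast
  let ?\<psi> = "the_inv_into (verts G) \<phi>"
  have "bij_betw ?\<psi> (verts H) (verts G)"
    by (rule bij_betw_the_inv_into) (rule \<phi>)
  moreover have "?\<psi> x \<in> verts G" "\<phi> (?\<psi> x) = x" if "x \<in> verts H" for x
    using that \<phi>(1) by (auto simp: bij_betw_def f_the_inv_into_f intro: the_inv_into_into)
  ultimately show ?thesis
    unfolding graph_isomorphic_def using \<phi>(2) by (intro exI[of _ ?\<psi>]) simp
qed

lemma graph_isomorphic_trans:
  assumes "graph_isomorphic G H" "graph_isomorphic H K"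
  shows "graph_isomorphic G K"
proof -
  obtain \<phi> where \<phi>: "bij_betw \<phi> (verts G) (verts H)"
    "\<And>x y. x \<in> verts G \<Longrightarrow> y \<in> verts G \<Longrightarrow> {x, y} \<in> edges G \<longleftrightarrow> {\<phi> x, \<phi> y} \<in> edges H"
    using assms(1) unfolding graph_isomorphic_def by blast
  obtain \<psi> where \<psi>: "bij_betw \<psi> (verts H) (verts K)"
    "\<And>x y. x \<in> verts H \<Longrightarrow> y \<in> verts H \<Longrightarrow> {x, y} \<in> edges H \<longleftrightarrow> {\<psi> x, \<psi> y} \<in> edges K"
    using assms(2) unfolding graph_isomorphic_def by blast
  have "\<phi> x \<in> verts H" if "x \<in> verts G" for x
    using that \<phi>(1) by (auto simp: bij_betw_def)
  then show ?thesis
    unfolding graph_isomorphic_def using \<phi>(2) \<psi>(2) bij_betw_trans[OF \<phi>(1) \<psi>(1)]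
    by (intro exI[of _ "\<psi> \<circ> \<phi>"]) auto
qed

section \<open>Positive null vectors of the Ricci matrix\<close>

definition star_sum :: "'a graph \<Rightarrow> ('a set \<Rightarrow> real) \<Rightarrow> 'a \<Rightarrow> real" where
  "star_sum G x z = (\<Sum>f | f \<in> edges G \<and> z \<in> f. x f)"

text \<open>The second conjunct is the row equation of \<open>ricci_matrix\<close>, sorted by the
  two endpoints of the edge. The star sum at an endpoint counts \<open>x e\<close> with weight +1
  where the diagonal entry has -1, hence the correction by \<open>2 * x e\<close>.\<close>

definition pos_ricci_null :: "'a graph \<Rightarrow> ('a set \<Rightarrow> real) \<Rightarrow> bool" where
  "pos_ricci_null G x \<longleftrightarrow> (\<forall>e\<in>edges G. x e > 0) \<and>
     (\<forall>e\<in>edges G. (\<Sum>z\<in>e. (star_sum G x z - 2 * x e) / vertex_degree G z) = 0)"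

lemma ricci_matrix_row:
  assumes "simple_graph G" "finite (edges G)" "e \<in> edges G"
  shows "(\<Sum>f\<in>edges G. ricci_matrix G e f * x f)
    = (\<Sum>z\<in>e. (star_sum G x z - 2 * x e) / vertex_degree G z)"
proof -
  let ?d = "\<lambda>z. real (vertex_degree G z)"
  have fe: "finite e"
    using assms finite_simple_edge by blast
  have entry: "ricci_matrix G e f * x f = (\<Sum>z\<in>e. if z \<in> f then x f / ?d z else 0)
      - (if e = f then \<Sum>z\<in>e. 2 * x e / ?d z else 0)" for f
  proof (cases "e = f")
    case True
    then show ?thesis
      by (simp add: ricci_matrix_def sum_distrib_right flip: sum_subtractf sum_negf)
  next
    case False
    have "(\<Sum>z\<in>e \<inter> f. 1 / ?d z) * x f = (\<Sum>z\<in>e. if z \<in> f then x f / ?d z else 0)"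
      unfolding sum_distrib_right sum.inter_restrict[OF fe] by (intro sum.cong refl) simp
    with False show ?thesis
      by (simp add: ricci_matrix_def)
  qed
  have star: "star_sum G x z / ?d z = (\<Sum>f\<in>edges G. if z \<in> f then x f / ?d z else 0)" for z
    unfolding star_sum_def sum_divide_distrib by (rule sum.inter_filter[OF assms(2)])
  have "(\<Sum>f\<in>edges G. ricci_matrix G e f * x f) =
      (\<Sum>f\<in>edges G. \<Sum>z\<in>e. if z \<in> f then x f / ?d z else 0) - (\<Sum>z\<in>e. 2 * x e / ?d z)"
    unfolding entry sum_subtractf using assms by simp
  also have "(\<Sum>f\<in>edges G. \<Sum>z\<in>e. if z \<in> f then x f / ?d z else 0)
      = (\<Sum>z\<in>e. \<Sum>f\<in>edges G. if z \<in> f then x f / ?d z else 0)"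
    by (rule sum.swap)
  also have "\<dots> = (\<Sum>z\<in>e. star_sum G x z / ?d z)"
    unfolding star by simp
  finally show ?thesis
    by (simp add: diff_divide_distrib sum_subtractf)
qed

lemma ricci_matrix_sym: "ricci_matrix G e f = ricci_matrix G f e"
  by (simp add: ricci_matrix_def Int_commute)

lemma ricci_matrix_offdiag_nonneg: "e \<noteq> f \<Longrightarrow> ricci_matrix G e f \<ge> 0"
  by (simp add: ricci_matrix_def sum_nonneg)

lemma vertex_degree_pos:
  assumes "finite (edges G)" "e \<in> edges G" "z \<in> e"
  shows "vertex_degree G z > 0"
  unfolding vertex_degree_def using assms by (auto simp: card_gt_0_iff)

lemma tree_vertex_degree_pos:
  assumes T: "is_tree T" and v: "v \<in> verts T"
  shows "vertex_degree T v > 0"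
proof -
  obtain a b where ab: "a \<in> verts T" "b \<in> verts T" "a \<noteq> b"
    using is_treeD(4)[OF T] simple_graphE[OF is_treeD(1)[OF T]] by (metis all_not_in_conv)
  then obtain y where "y \<in> verts T" "y \<noteq> v"
    by metis
  then have "(\<lambda>u v. {u, v} \<in> edges T)\<^sup>*\<^sup>* v y"
    using is_treeD(5)[OF T] v by (auto simp: graph_connected_def)
  then obtain z where "{v, z} \<in> edges T"
    using \<open>y \<noteq> v\<close> by (auto elim: converse_rtranclpE)
  then show ?thesis
    using vertex_degree_pos[OF is_treeD(3)[OF T]] by blast
qed

lemma ricci_lambda_max_eq_0_if_null:
  assumes "simple_graph G" "finite (edges G)" "edges G \<noteq> {}" "pos_ricci_null G x"
  shows "ricci_lambda_max G = 0"
  using assms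
  by (intro lambda_max_on_eq_0_if_pos_null_vector[where x = x] ricci_matrix_offdiag_nonneg ricci_matrix_sym)
    (auto simp: pos_ricci_null_def ricci_matrix_row)

lemma pos_null_vector_exists_if_ricci_lambda_max_eq_0:
  assumes T: "is_tree T" and l0: "ricci_lambda_max T = 0"
  shows "\<exists>x. pos_ricci_null T x"
proof -
  note TD = is_treeD[OF T]
  obtain y where y: "\<And>e. y e \<ge> 0" "\<exists>e\<in>edges T. y e \<noteq> 0"
    "\<And>e. e \<in> edges T \<Longrightarrow> (\<Sum>f\<in>edges T. ricci_matrix T e f * y f) = 0"
    using nonneg_max_eigenvector_exists[where A = "ricci_matrix T", OF TD(3,4)
        ricci_matrix_sym ricci_matrix_offdiag_nonneg] l0 by auto
  \<comment> \<open>Irreducibility: at an edge \<open>e\<close> of value 0 the row sum has only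
    nonnegative terms, and the adjacent edge \<open>f\<close> makes it positive.\<close>
  have spread: "y e > 0" if e: "e \<in> edges T" and f: "f \<in> edges T" "y f > 0" and z: "z \<in> e" "z \<in> f" for e f z
  proof (rule ccontr)
    assume "\<not> y e > 0"
    then have ye: "y e = 0" "e \<noteq> f"
      using y(1)[of e] f by auto
    have nn: "ricci_matrix T e g * y g \<ge> 0" if "g \<in> edges T" for g
      using y(1)[of g] ye ricci_matrix_offdiag_nonneg[of e g T] by (cases "e = g") auto
    have fin: "finite (e \<inter> f)"
      using finite_simple_edge TD(1) e by blast
    have "ricci_matrix T e f > 0"
      unfolding ricci_matrix_def
      using ye z vertex_degree_pos[OF TD(3) e z(1)] fin by (auto intro!: sum_pos2[where i = z])
    then have "(\<Sum>g\<in>edges T. ricci_matrix T e g * y g) > 0"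
      using f nn by (intro sum_pos2[OF TD(3)]) auto
    with y(3)[OF e] show False
      by simp
  qed
  obtain f where f: "f \<in> edges T" "y f > 0"
    using y(1,2) by (metis less_eq_real_def)
  obtain u where u: "u \<in> f" "u \<in> verts T"
    using simple_graphE[OF TD(1) f(1)] by (metis insertI1)
  \<comment> \<open>Connectedness carries positivity from \<open>f\<close> to the whole tree, since
    the set of endpoints of positive edges is closed under adjacency.\<close>
  define S where "S = {v. \<exists>f\<in>edges T. v \<in> f \<and> y f > 0}"
  have "verts T \<subseteq> S"
  proof (rule connected_closed_set[OF TD(5) _ u(2)])
    fix a b assume "a \<in> S" "{a, b} \<in> edges T"
    then show "b \<in> S"
      unfolding S_def using spread[of "{a, b}"] by blast
  qed (use f u in \<open>auto simp: S_def\<close>)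
  have "y e > 0" if e: "e \<in> edges T" for e
  proof -
    obtain a where a: "a \<in> e" "a \<in> verts T"
      using simple_graphE[OF TD(1) e] by (metis insertI1)
    then show ?thesis
      using \<open>verts T \<subseteq> S\<close> spread[OF e] unfolding S_def by blast
  qed
  then show ?thesis
    using y(3) ricci_matrix_row[OF TD(1,3)] by (intro exI[of _ y]) (auto simp: pos_ricci_null_def)
qed

section \<open>Energy of edge weightings and attached leaves\<close>

definition ricci_energy :: "'a graph \<Rightarrow> ('a set \<Rightarrow> real) \<Rightarrow> real" where
  "ricci_energy G x =
     (\<Sum>z\<in>verts G. ((star_sum G x z)\<^sup>2 - 2 * star_sum G (\<lambda>e. (x e)\<^sup>2) z) / vertex_degree G z)"

text \<open>Exchanging the sums over edges and vertices collects the form into one local term per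
  vertex, which makes attaching a leaf a local change.\<close>

lemma ricci_quad_form_eq_energy:
  assumes "simple_graph G" "finite (verts G)"
  shows "quad_form_on (edges G) (ricci_matrix G) x = ricci_energy G x"
proof -
  have fin: "finite (edges G)"
    using finite_edges assms by blast
  have "quad_form_on (edges G) (ricci_matrix G) x =
      (\<Sum>e\<in>edges G. \<Sum>z\<in>e. x e * ((star_sum G x z - 2 * x e) / vertex_degree G z))"
    unfolding quad_form_on_def using assms fin by (simp add: ricci_matrix_row sum_distrib_left)
  also have "\<dots> = (\<Sum>e\<in>edges G. \<Sum>z\<in>verts G. if z \<in> e then x e * ((star_sum G x z - 2 * x e) / vertex_degree G z) else 0)"
  proof (rule sum.cong[OF refl])
    fix e assume "e \<in> edges G"
    then have "verts G \<inter> e = e"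
      using assms(1) by (auto simp: simple_graph_def)
    then show "(\<Sum>z\<in>e. x e * ((star_sum G x z - 2 * x e) / vertex_degree G z)) =
        (\<Sum>z\<in>verts G. if z \<in> e then x e * ((star_sum G x z - 2 * x e) / vertex_degree G z) else 0)"
      using sum.inter_restrict[OF assms(2), of "\<lambda>z. x e * ((star_sum G x z - 2 * x e) / vertex_degree G z)" e]
      by (simp only:)
  qed
  also have "\<dots> = (\<Sum>z\<in>verts G. \<Sum>e\<in>edges G. if z \<in> e then x e * ((star_sum G x z - 2 * x e) / vertex_degree G z) else 0)"
    by (rule sum.swap)
  also have "\<dots> = ricci_energy G x"
    unfolding ricci_energy_def
  proof (rule sum.cong[OF refl])
    fix z
    have "(\<Sum>e\<in>edges G. if z \<in> e then x e * ((star_sum G x z - 2 * x e) / vertex_degree G z) else 0)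
      = (\<Sum>e | e \<in> edges G \<and> z \<in> e. x e * ((star_sum G x z - 2 * x e) / vertex_degree G z))"
      by (rule sum.inter_filter[OF fin, symmetric])
    also have "\<dots> = (\<Sum>e | e \<in> edges G \<and> z \<in> e. x e * star_sum G x z - 2 * (x e)\<^sup>2) / vertex_degree G z"
      unfolding sum_divide_distrib by (intro sum.cong refl) (simp add: power2_eq_square algebra_simps)
    also have "(\<Sum>e | e \<in> edges G \<and> z \<in> e. x e * star_sum G x z - 2 * (x e)\<^sup>2) =
        (star_sum G x z)\<^sup>2 - 2 * star_sum G (\<lambda>e. (x e)\<^sup>2) z"
      by (simp add: sum_subtractf star_sum_def power2_eq_square flip: sum_distrib_left sum_distrib_right)
    finally show "(\<Sum>e\<in>edges G. if z \<in> e then x e * ((star_sum G x z - 2 * x e) / vertex_degree G z) else 0)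
      = ((star_sum G x z)\<^sup>2 - 2 * star_sum G (\<lambda>e. (x e)\<^sup>2) z) / vertex_degree G z" .
  qed
  finally show ?thesis .
qed

lemma star_sum_power2_le:
  assumes "finite (edges G)"
  shows "(star_sum G x z)\<^sup>2 \<le> vertex_degree G z * star_sum G (\<lambda>e. (x e)\<^sup>2) z"
  using sum_squared_le_sum_of_squares[of x "{f \<in> edges G. z \<in> f}"] assms
  by (simp add: star_sum_def vertex_degree_def mult.commute)

text \<open>The summand 2 in \<open>(d + 2) * q - S\<^sup>2\<close> leaves a surplus of at least
  \<open>2 * q\<close> over Cauchy-Schwarz, so the gain is strict even when all values at the vertex
  agree. The square subtracted on the left is the term of the new leaf, which has degree 1.\<close>

lemma leaf_energy_gain:
  fixes S q d :: real
  assumes "d > 0" "S\<^sup>2 \<le> d * q" "q > 0"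
  shows "((S + S / (d + 2))\<^sup>2 - 2 * (q + (S / (d + 2))\<^sup>2)) / (d + 1) - (S / (d + 2))\<^sup>2 > (S\<^sup>2 - 2 * q) / d"
proof -
  have "((S + S / (d + 2))\<^sup>2 - 2 * (q + (S / (d + 2))\<^sup>2)) / (d + 1) - (S / (d + 2))\<^sup>2 - (S\<^sup>2 - 2 * q) / d
     = 2 * ((d + 2) * q - S\<^sup>2) / (d * (d + 1) * (d + 2))"
    using assms(1) by (simp add: divide_simps) (simp add: power2_eq_square algebra_simps)
  also have "\<dots> > 0"
    using assms by (intro divide_pos_pos mult_pos_pos) (auto simp: algebra_simps add_pos_pos intro: le_less_trans)
  finally show ?thesis
    by simp
qed

text \<open>The value on the new edge maximizes the energy of the enlarged graph.\<close>

lemma ricci_energy_add_leaf: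
  assumes G: "simple_graph G" "finite (verts G)" and pos: "\<forall>e\<in>edges G. x e > 0"
    and vw: "v \<in> verts G" "w \<notin> verts G" and d: "vertex_degree G v > 0"
  shows "\<exists>x'. (\<forall>e\<in>edges (add_leaf G v w). x' e > 0) \<and> ricci_energy (add_leaf G v w) x' > ricci_energy G x"
proof -
  have fin: "finite (edges G)"
    using finite_edges G by blast
  let ?H = "add_leaf G v w"
  define y where "y = star_sum G x v / (vertex_degree G v + 2)"
  define x' where "x' = x({v, w} := y)"
  have inc_ne: "{e \<in> edges G. v \<in> e} \<noteq> {}"
    using d by (auto simp: vertex_degree_def card_gt_0_iff)
  have S: "star_sum G x v > 0" and q: "star_sum G (\<lambda>e. (x e)\<^sup>2) v > 0"
    unfolding star_sum_def using pos fin inc_ne by (auto intro!: sum_pos)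
  then have y: "y > 0"
    by (simp add: y_def)
  have w: "w \<notin> e" if "e \<in> edges G" for e
    using that G vw by (auto simp: simple_graph_def)
  then have new: "{v, w} \<notin> edges G"
    by blast
  have "v \<noteq> w"
    using vw by blast
  have inc: "{f \<in> edges ?H. z \<in> f} = {f \<in> edges G. z \<in> f}" if "z \<noteq> v" "z \<noteq> w" for z
    using that by auto
  have incv: "{f \<in> edges ?H. v \<in> f} = insert {v, w} {f \<in> edges G. v \<in> f}"
    by auto
  have incw: "{f \<in> edges ?H. w \<in> f} = {{v, w}}"
    using w by auto
  \<comment> \<open>Stated for an arbitrary \<open>g\<close> to cover both the sum of the values and
    the sum of their squares.\<close>
  have other: "star_sum ?H (\<lambda>e. g (x' e)) z = star_sum G (\<lambda>e. g (x e)) z" "vertex_degree ?H z = vertex_degree G z"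
    if "z \<in> verts G - {v}" for z and g :: "real \<Rightarrow> real"
  proof -
    have z: "z \<noteq> v" "z \<noteq> w"
      using that vw by auto
    have "(\<Sum>e | e \<in> edges G \<and> z \<in> e. g (x' e)) = (\<Sum>e | e \<in> edges G \<and> z \<in> e. g (x e))"
      using new by (intro sum.cong) (auto simp: x'_def)
    then show "star_sum ?H (\<lambda>e. g (x' e)) z = star_sum G (\<lambda>e. g (x e)) z" "vertex_degree ?H z = vertex_degree G z"
      unfolding star_sum_def vertex_degree_def inc[OF z] by simp_all
  qed
  have at_v: "star_sum ?H (\<lambda>e. g (x' e)) v = star_sum G (\<lambda>e. g (x e)) v + g y"
    "vertex_degree ?H v = vertex_degree G v + 1" for g :: "real \<Rightarrow> real"
  proof -
    have "(\<Sum>e | e \<in> edges G \<and> v \<in> e. g (x' e)) = (\<Sum>e | e \<in> edges G \<and> v \<in> e. g (x e))"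
      using new by (intro sum.cong) (auto simp: x'_def)
    then show "star_sum ?H (\<lambda>e. g (x' e)) v = star_sum G (\<lambda>e. g (x e)) v + g y"
      unfolding star_sum_def incv using fin new by (simp add: x'_def)
    show "vertex_degree ?H v = vertex_degree G v + 1"
      unfolding vertex_degree_def incv using fin new by simp
  qed
  have at_w: "star_sum ?H (\<lambda>e. g (x' e)) w = g y" "vertex_degree ?H w = 1" for g :: "real \<Rightarrow> real"
    unfolding star_sum_def vertex_degree_def incw by (simp_all add: x'_def)
  let ?t = "\<lambda>G x z. ((star_sum G x z)\<^sup>2 - 2 * star_sum G (\<lambda>e. (x e)\<^sup>2) z) / real (vertex_degree G z)"
  have rest: "(\<Sum>z\<in>verts G - {v}. ?t ?H x' z) = (\<Sum>z\<in>verts G - {v}. ?t G x z)"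
    using other(1)[of _ "\<lambda>t. t"] other(1)[of _ "\<lambda>t. t\<^sup>2"] other(2) by (intro sum.cong) auto
  have "ricci_energy ?H x' = ?t ?H x' w + (?t ?H x' v + (\<Sum>z\<in>verts G - {v}. ?t ?H x' z))"
    unfolding ricci_energy_def using vw G(2) by (simp add: sum.remove[of "verts G" v])
  moreover have "ricci_energy G x = ?t G x v + (\<Sum>z\<in>verts G - {v}. ?t G x z)"
    unfolding ricci_energy_def using vw G(2) by (simp add: sum.remove[of "verts G" v])
  moreover have "?t ?H x' w = - y\<^sup>2"
    using at_w(1)[of "\<lambda>t. t"] at_w(1)[of "\<lambda>t. t\<^sup>2"] at_w(2) by simp
  moreover have "?t ?H x' v - y\<^sup>2 > ?t G x v"
    using leaf_energy_gain[OF _ star_sum_power2_le[OF fin, of x v] q] d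
      at_v(1)[of "\<lambda>t. t"] at_v(1)[of "\<lambda>t. t\<^sup>2"] at_v(2) by (simp add: y_def add.commute)
  ultimately have "ricci_energy ?H x' > ricci_energy G x"
    using rest by linarith
  moreover have "\<forall>e\<in>edges ?H. x' e > 0"
    using pos y by (auto simp: x'_def)
  ultimately show ?thesis
    by blast
qed

text \<open>Induction on the number of vertices of \<open>T\<close> still missing from
  \<open>H\<close>. Positivity of the edge values is carried along because the gain at the next leaf
  relies on it.\<close>

lemma ricci_energy_proper_subtree:
  assumes T: "is_tree T" and "is_tree H" "subgraph_of H T" "H \<noteq> T" "\<forall>e\<in>edges H. x e > 0"
  shows "\<exists>x'. (\<forall>e\<in>edges T. x' e > 0) \<and> ricci_energy T x' > ricci_energy H x"
  using assms(2-)
proof (induction "card (verts T - verts H)" arbitrary: H x rule: less_induct)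
  case less
  note H = less.prems
  obtain v w where vw: "v \<in> verts H" "w \<in> verts T" "w \<notin> verts H" "{v, w} \<in> edges T"
    using proper_subtree_neighbour[OF T H(1-3)] .
  let ?H' = "add_leaf H v w"
  note H' = is_tree_add_leaf[OF T H(1,2) vw]
  obtain x' where x': "\<forall>e\<in>edges ?H'. x' e > 0" "ricci_energy ?H' x' > ricci_energy H x"
    using ricci_energy_add_leaf[OF is_treeD(1,2)[OF H(1)] H(4) vw(1,3) tree_vertex_degree_pos[OF H(1) vw(1)]]
    by blast
  show ?case
  proof (cases "?H' = T")
    case True
    with x' show ?thesis
      by auto
  next
    case False
    have "verts T - verts ?H' \<subset> verts T - verts H"
      using vw by auto
    then have "card (verts T - verts ?H') < card (verts T - verts H)"
      using is_treeD(2)[OF T] by (intro psubset_card_mono) auto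
    from less.hyps[OF this H' False x'(1)] x'(2) show ?thesis
      by (auto intro: less_trans)
  qed
qed

text \<open>A null vector of \<open>H\<close> has energy 0, so the larger tree has a vector of
  positive energy, and the Rayleigh bound turns this into a positive eigenvalue.\<close>

lemma ricci_lambda_max_pos_if_null_proper_subtree:
  assumes T: "is_tree T" and H: "is_tree H" "subgraph_of H T" "H \<noteq> T" and x: "pos_ricci_null H x"
  shows "ricci_lambda_max T > 0"
proof -
  note TD = is_treeD[OF T] and HD = is_treeD[OF H(1)]
  have "ricci_energy H x = 0"
    using x by (simp add: quad_form_on_def ricci_matrix_row[OF HD(1,3)] pos_ricci_null_def
        flip: ricci_quad_form_eq_energy[OF HD(1,2)])
  moreover have "\<forall>e\<in>edges H. x e > 0"
    using x by (simp add: pos_ricci_null_def)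
  ultimately obtain x' where "ricci_energy T x' > 0"
    using ricci_energy_proper_subtree[OF T H, of x] by auto
  then have "0 < ricci_lambda_max T * (\<Sum>e\<in>edges T. (x' e)\<^sup>2)"
    using lambda_max_on_rayleigh(2)[where A = "ricci_matrix T" and x = x', OF TD(3,4) ricci_matrix_sym]
    by (simp add: ricci_quad_form_eq_energy[OF TD(1,2)])
  moreover have "(\<Sum>e\<in>edges T. (x' e)\<^sup>2) \<ge> 0"
    by (intro sum_nonneg) simp
  ultimately show ?thesis
    by (simp add: zero_less_mult_iff)
qed

text \<open>For trees, largest eigenvalue 0 is equivalent to having a positive null vector, so
  pulling such vectors back along isomorphisms replaces a comparison of spectra.\<close>

lemma pos_ricci_null_isomorphic:
  assumes G: "simple_graph G" and H: "simple_graph H" and iso: "graph_isomorphic G H"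
    and x: "pos_ricci_null H x"
  shows "\<exists>x'. pos_ricci_null G x'"
proof -
  obtain \<phi> where \<phi>: "bij_betw \<phi> (verts G) (verts H)"
    "\<And>x y. x \<in> verts G \<Longrightarrow> y \<in> verts G \<Longrightarrow> {x, y} \<in> edges G \<longleftrightarrow> {\<phi> x, \<phi> y} \<in> edges H"
    using iso unfolding graph_isomorphic_def by blast
  have E: "edges H = (`) \<phi> ` edges G"
    using graph_isomorphic_edges[OF G H \<phi>] .
  have sub: "e \<subseteq> verts G" if "e \<in> edges G" for e
    using G that by (auto simp: simple_graph_def)
  have inj: "inj_on \<phi> (verts G)"
    using \<phi>(1) by (rule bij_betw_imp_inj_on)
  have injE: "inj_on ((`) \<phi>) (edges G)"
    by (rule inj_on_subset[OF inj_on_image_Pow[OF inj]]) (use sub in auto)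
  have inc: "{f \<in> edges H. \<phi> z \<in> f} = (`) \<phi> ` {f \<in> edges G. z \<in> f}" if "z \<in> verts G" for z
  proof -
    have "\<phi> z \<in> \<phi> ` f \<longleftrightarrow> z \<in> f" if "f \<in> edges G" for f
      using inj_on_image_mem_iff[OF inj \<open>z \<in> verts G\<close> sub[OF that]] .
    then show ?thesis
      unfolding E by auto
  qed
  have injI: "inj_on ((`) \<phi>) {f \<in> edges G. z \<in> f}" for z
    by (rule inj_on_subset[OF injE]) auto
  let ?x = "\<lambda>e. x (\<phi> ` e)"
  have S: "star_sum H x (\<phi> z) = star_sum G ?x z" "vertex_degree H (\<phi> z) = vertex_degree G z"
    if "z \<in> verts G" for z
    unfolding star_sum_def vertex_degree_def inc[OF that]
    by (simp_all add: sum.reindex[OF injI] card_image[OF injI])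
  have "(\<Sum>z\<in>e. (star_sum G ?x z - 2 * ?x e) / vertex_degree G z) = 0" if e: "e \<in> edges G" for e
  proof -
    have "(\<Sum>z\<in>\<phi> ` e. (star_sum H x z - 2 * ?x e) / vertex_degree H z) = 0"
      using x e E by (auto simp: pos_ricci_null_def)
    also have "(\<Sum>z\<in>\<phi> ` e. (star_sum H x z - 2 * ?x e) / vertex_degree H z) =
        (\<Sum>z\<in>e. (star_sum H x (\<phi> z) - 2 * ?x e) / vertex_degree H (\<phi> z))"
      using sum.reindex[OF inj_on_subset[OF inj sub[OF e]]] by simp
    also have "\<dots> = (\<Sum>z\<in>e. (star_sum G ?x z - 2 * ?x e) / vertex_degree G z)"
      using sub[OF e] S by (intro sum.cong refl) (auto simp: subset_iff)
    finally show ?thesis .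
  qed
  then show ?thesis
    using x E by (intro exI[of _ ?x]) (auto simp: pos_ricci_null_def)
qed

section \<open>Reduction of caterpillars to the spine\<close>

lemma caterpillar_tree_sel:
  "verts (caterpillar_tree a) = {(i, j) | i j. i < length a \<and> j \<le> a ! i}"
  "edges (caterpillar_tree a) = {{(i, 0), (Suc i, 0)} | i. Suc i < length a} \<union>
      {{(i, 0), (i, j)} | i j. i < length a \<and> 1 \<le> j \<and> j \<le> a ! i}"
  by (simp_all add: caterpillar_tree_def)

lemma simple_caterpillar_tree: "simple_graph (caterpillar_tree a)"
  unfolding simple_graph_def caterpillar_tree_sel by (auto simp: card_insert_if)

lemma caterpillar_spine_incident:
  assumes "i < length a"
  shows "{f \<in> edges (caterpillar_tree a). (i, 0) \<in> f} =
    (if 0 < i then {{(i - 1, 0), (i, 0)}} else {}) \<union>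
    (if Suc i < length a then {{(i, 0), (Suc i, 0)}} else {}) \<union>
    (\<lambda>j. {(i, 0), (i, j)}) ` {1..a ! i}" (is "?L = ?R")
proof (intro equalityI subsetI)
  fix f assume "f \<in> ?L"
  then consider k where "f = {(k, 0), (Suc k, 0)}" "Suc k < length a" "i = k \<or> i = Suc k"
    | j where "f = {(i, 0), (i, j)}" "1 \<le> j" "j \<le> a ! i"
    by (auto simp: caterpillar_tree_sel)
  then show "f \<in> ?R"
    by cases auto
next
  fix f assume "f \<in> ?R"
  then consider "0 < i" "f = {(i - 1, 0), (i, 0)}" | "Suc i < length a" "f = {(i, 0), (Suc i, 0)}"
    | j where "f = {(i, 0), (i, j)}" "1 \<le> j" "j \<le> a ! i"
    by (auto split: if_splits)
  then show "f \<in> ?L"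
  proof cases
    case 1
    then have "f = {(i - 1, 0), (Suc (i - 1), 0)}" "Suc (i - 1) < length a"
      using assms by auto
    with 1 show ?thesis
      by (auto simp: caterpillar_tree_sel)
  qed (use assms in \<open>auto simp: caterpillar_tree_sel\<close>)
qed

lemma caterpillar_spine_star_sum:
  assumes "i < length a"
  shows "star_sum (caterpillar_tree a) x (i, 0) =
    (if 0 < i then x {(i - 1, 0), (i, 0)} else 0) +
    (if Suc i < length a then x {(i, 0), (Suc i, 0)} else 0) +
    (\<Sum>j = 1..a ! i. x {(i, 0), (i, j)})"
proof -
  define A where "A = (if 0 < i then {{(i - 1, 0 :: nat), (i, 0)}} else {})"
  define B where "B = (if Suc i < length a then {{(i, 0 :: nat), (Suc i, 0)}} else {})"
  define C where "C = (\<lambda>j. {(i, 0 :: nat), (i, j)}) ` {1..a ! i}"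
  have fin: "finite A" "finite B" "finite C"
    by (simp_all add: A_def B_def C_def)
  have "inj_on (\<lambda>j. {(i, 0 :: nat), (i, j)}) {1..a ! i}"
    by (auto simp: inj_on_def doubleton_eq_iff)
  then have C: "sum x C = (\<Sum>j = 1..a ! i. x {(i, 0), (i, j)})"
    unfolding C_def by (simp add: sum.reindex)
  have AB: "sum x A = (if 0 < i then x {(i - 1, 0), (i, 0)} else 0)"
    "sum x B = (if Suc i < length a then x {(i, 0), (Suc i, 0)} else 0)"
    by (simp_all add: A_def B_def)
  \<comment> \<open>The two spine edges are told apart by the vertex \<open>(Suc i, 0)\<close>, and
    the leaf edges from both by an endpoint with nonzero second coordinate.\<close>
  have "(Suc i, 0) \<notin> f" if "f \<in> A" for f
    using that by (simp add: A_def split: if_splits)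
  moreover have "(Suc i, 0) \<in> f" if "f \<in> B" for f
    using that by (simp add: B_def split: if_splits)
  ultimately have AB_disj: "A \<inter> B = {}"
    by (meson disjoint_iff)
  have "\<forall>p\<in>f. snd p = 0" if "f \<in> A \<union> B" for f
    using that by (auto simp: A_def B_def split: if_splits)
  moreover have "\<exists>p\<in>f. snd p \<noteq> 0" if "f \<in> C" for f
    using that by (auto simp: C_def)
  ultimately have ABC_disj: "(A \<union> B) \<inter> C = {}"
    by (meson disjoint_iff)
  have "sum x (A \<union> B \<union> C) = sum x (A \<union> B) + sum x C"
    by (rule sum.union_disjoint[OF _ _ ABC_disj]) (use fin in auto)
  also have "sum x (A \<union> B) = sum x A + sum x B"
    by (rule sum.union_disjoint[OF fin(1,2) AB_disj])
  finally show ?thesis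
    unfolding star_sum_def caterpillar_spine_incident[OF assms] AB C unfolding A_def B_def C_def .
qed

text \<open>Lets one computation of star sums on a caterpillar serve for the degrees as
  well.\<close>

lemma vertex_degree_eq_star_sum: "real (vertex_degree G z) = star_sum G (\<lambda>_. 1) z"
  by (simp add: vertex_degree_def star_sum_def)

lemma caterpillar_leaf_incident:
  assumes "i < length a" "1 \<le> j" "j \<le> a ! i"
  shows "{f \<in> edges (caterpillar_tree a). (i, j) \<in> f} = {{(i, 0), (i, j)}}"
  using assms by (auto simp: caterpillar_tree_sel)

definition spine_nbrs :: "nat \<Rightarrow> nat \<Rightarrow> nat" where
  "spine_nbrs m i = (if 0 < i then 1 else 0) + (if Suc i < m then 1 else 0)"

text \<open>\<open>s i\<close> is the value on the spine edge between the spine vertices \<open>i - 1\<close> and \<open>i\<close>. Eliminating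
  the leaf edges at the spine vertex \<open>i\<close> turns the mean of the values at this vertex into
  \<open>spine_mean m a s i\<close>.\<close>

definition spine_mean :: "nat \<Rightarrow> (nat \<Rightarrow> nat) \<Rightarrow> (nat \<Rightarrow> real) \<Rightarrow> nat \<Rightarrow> real" where
  "spine_mean m a s i = real (spine_nbrs m i + a i + 2) / (real (spine_nbrs m i + a i) * real (spine_nbrs m i + 2))
     * (s i + s (Suc i))"

text \<open>What the vertex \<open>i - 1\<close> contributes to the row equation of the spine edge
  \<open>i\<close> once its leaves are eliminated; \<open>right_load\<close> is the contribution of
  the vertex \<open>i\<close>. The row equation says that the two loads cancel.\<close>

definition left_load :: "nat \<Rightarrow> (nat \<Rightarrow> nat) \<Rightarrow> (nat \<Rightarrow> real) \<Rightarrow> nat \<Rightarrow> real" where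
  "left_load m a s i = spine_mean m a s (i - 1) - 2 * s i / real (spine_nbrs m (i - 1) + a (i - 1))"

definition right_load :: "nat \<Rightarrow> (nat \<Rightarrow> nat) \<Rightarrow> (nat \<Rightarrow> real) \<Rightarrow> nat \<Rightarrow> real" where
  "right_load m a s i = spine_mean m a s i - 2 * s i / real (spine_nbrs m i + a i)"

text \<open>The boundary values 0 stand for the missing spine edges beyond both ends, so that
  \<open>spine_mean\<close> has the same form at the end vertices as inside.\<close>

definition spine_null :: "nat \<Rightarrow> (nat \<Rightarrow> nat) \<Rightarrow> (nat \<Rightarrow> real) \<Rightarrow> bool" where
  "spine_null m a s \<longleftrightarrow> s 0 = 0 \<and> s m = 0 \<and>
     (\<forall>i. 0 < i \<and> i < m \<longrightarrow> s i > 0 \<and> left_load m a s i + right_load m a s i = 0)"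

lemma caterpillar_spine_degree:
  assumes "i < length a"
  shows "vertex_degree (caterpillar_tree a) (i, 0) = spine_nbrs (length a) i + a ! i"
proof -
  have "real (vertex_degree (caterpillar_tree a) (i, 0)) = real (spine_nbrs (length a) i + a ! i)"
    unfolding vertex_degree_eq_star_sum caterpillar_spine_star_sum[OF assms]
    by (simp add: spine_nbrs_def)
  then show ?thesis
    by simp
qed

lemma spine_nbrs_pos: "m \<ge> 2 \<Longrightarrow> i < m \<Longrightarrow> spine_nbrs m i > 0"
  by (auto simp: spine_nbrs_def)

text \<open>Consequently all leaf edges at one spine vertex carry the same multiple of its star sum,
  which is what makes them eliminable.\<close>

lemma caterpillar_leaf_equation:
  assumes i: "i < length a" and j: "1 \<le> j" "j \<le> a ! i"
  shows "(\<Sum>z\<in>{(i, 0), (i, j)}. (star_sum (caterpillar_tree a) x z - 2 * x {(i, 0), (i, j)})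
      / vertex_degree (caterpillar_tree a) z) = 0 \<longleftrightarrow>
    star_sum (caterpillar_tree a) x (i, 0) = real (spine_nbrs (length a) i + a ! i + 2) * x {(i, 0), (i, j)}"
proof -
  have "star_sum (caterpillar_tree a) x (i, j) = x {(i, 0), (i, j)}" "vertex_degree (caterpillar_tree a) (i, j) = 1"
    unfolding star_sum_def vertex_degree_def caterpillar_leaf_incident[OF assms] by simp_all
  with j show ?thesis
    by (simp add: caterpillar_spine_degree[OF i] divide_simps) argo
qed

lemma caterpillar_spine_null:
  assumes m: "length a \<ge> 2" and null: "pos_ricci_null (caterpillar_tree a) x"
  defines "s \<equiv> \<lambda>i. if 0 < i \<and> i < length a then x {(i - 1, 0), (i, 0)} else 0"
  shows "spine_null (length a) (\<lambda>i. a ! i) s"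
proof -
  let ?T = "caterpillar_tree a" and ?m = "length a"
  have mean: "star_sum ?T x (i, 0) / vertex_degree ?T (i, 0) = spine_mean ?m (\<lambda>i. a ! i) s i"
    if i: "i < ?m" for i
  proof -
    let ?S = "star_sum ?T x (i, 0)" and ?b = "real (spine_nbrs ?m i)" and ?a = "real (a ! i)"
    have "x {(i, 0), (i, j)} = ?S / (?b + ?a + 2)" if "j \<in> {1..a ! i}" for j
    proof -
      have "{(i, 0), (i, j)} \<in> edges ?T"
        using i that by (auto simp: caterpillar_tree_sel)
      then show ?thesis
        using null that caterpillar_leaf_equation[OF i, of j x]
        by (auto simp: pos_ricci_null_def divide_simps mult.commute)
    qed
    then have "(\<Sum>j = 1..a ! i. x {(i, 0), (i, j)}) = ?a * (?S / (?b + ?a + 2))"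
      by simp
    \<comment> \<open>\<open>?S\<close> occurs on both sides because the leaf values are multiples
      of it; solving for it gives the factor in \<open>spine_mean\<close>.\<close>
    then have "?S = s i + s (Suc i) + ?a * (?S / (?b + ?a + 2))"
      using i by (subst caterpillar_spine_star_sum[OF i]) (simp add: s_def)
    then have "?S * (?b + 2) = (?b + ?a + 2) * (s i + s (Suc i))"
      by (simp add: divide_simps) (simp add: algebra_simps)
    moreover have "?b > 0"
      using spine_nbrs_pos[OF m i] by simp
    ultimately show ?thesis
      unfolding caterpillar_spine_degree[OF i] spine_mean_def by (simp add: divide_simps) (simp add: algebra_simps)
  qed
  have "s i > 0 \<and> left_load ?m (\<lambda>i. a ! i) s i + right_load ?m (\<lambda>i. a ! i) s i = 0"
    if i: "0 < i" "i < ?m" for i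
  proof -
    have "{(i - 1, 0), (Suc (i - 1), 0)} \<in> edges ?T"
      using i unfolding caterpillar_tree_sel by force
    then have e: "{(i - 1, 0), (i, 0)} \<in> edges ?T"
      using i by simp
    have si: "x {(i - 1, 0), (i, 0)} = s i"
      using i by (simp add: s_def)
    have "(\<Sum>z\<in>{(i - 1, 0), (i, 0)}. (star_sum ?T x z - 2 * s i) / vertex_degree ?T z) = 0"
      using null e unfolding pos_ricci_null_def si[symmetric] by blast
    moreover have "s i > 0"
      using null e unfolding pos_ricci_null_def si[symmetric] by blast
    ultimately show ?thesis
      using i mean[of i] mean[of "i - 1"] caterpillar_spine_degree[of i a] caterpillar_spine_degree[of "i - 1" a]
      by (auto simp: left_load_def right_load_def diff_divide_distrib)
  qed
  then show ?thesis
    by (simp add: spine_null_def s_def)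
qed

lemma caterpillar_null_if_spine_null:
  assumes m: "length a \<ge> 2" and null: "spine_null (length a) (\<lambda>i. a ! i) s"
  shows "\<exists>x. pos_ricci_null (caterpillar_tree a) x"
proof -
  let ?T = "caterpillar_tree a" and ?m = "length a"
  let ?d = "\<lambda>i. real (spine_nbrs ?m i + a ! i)" and ?M = "spine_mean ?m (\<lambda>i. a ! i) s"
  \<comment> \<open>Both kinds of edges are decoded from their vertex sets. A spine edge has second
    coordinates 0, and its larger first coordinate is its index in \<open>s\<close>; on a leaf edge
    both first coordinates are the spine position.\<close>
  define x where "x e = (if \<forall>p\<in>e. snd p = (0 :: nat) then s (Max (fst ` e))
    else ?M (Max (fst ` e)) * ?d (Max (fst ` e)) / (?d (Max (fst ` e)) + 2))" for e
  have x_spine: "x {(i - 1, 0), (i, 0)} = s i" "x {(i, 0), (Suc i, 0)} = s (Suc i)" for i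
    by (simp_all add: x_def)
  have x_leaf: "x {(i, 0), (i, j)} = ?M i * ?d i / (?d i + 2)" if "1 \<le> j" for i j
    using that by (simp add: x_def)
  have d: "?d i > 0" if "i < ?m" for i
    using spine_nbrs_pos[OF m that] by simp
  have ends: "s 0 = 0" "s ?m = 0" and s_pos: "\<And>i. 0 < i \<Longrightarrow> i < ?m \<Longrightarrow> s i > 0"
    using null by (auto simp: spine_null_def)
  have M_pos: "?M i > 0" if i: "i < ?m" for i
  proof -
    have "s k \<ge> 0" if "k \<le> ?m" for k
      using ends s_pos that by (metis le_neq_implies_less less_imp_le order_refl zero_less_iff_neq_zero)
    moreover have "s i > 0 \<or> s (Suc i) > 0"
      using s_pos[of i] s_pos[of "Suc i"] i m by (cases i) auto
    ultimately have "s i + s (Suc i) > 0"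
      using i by (metis Suc_leI add_nonneg_pos add_pos_nonneg less_imp_le)
    then show ?thesis
      using d[OF i] spine_nbrs_pos[OF m i] unfolding spine_mean_def
      by (intro mult_pos_pos divide_pos_pos) auto
  qed
  have star: "star_sum ?T x (i, 0) = ?M i * ?d i" if i: "i < ?m" for i
  proof -
    let ?b = "real (spine_nbrs ?m i)"
    have "star_sum ?T x (i, 0) = s i + s (Suc i) + real (a ! i) * (?M i * ?d i / (?d i + 2))"
    proof -
      have "Suc i < ?m \<or> Suc i = ?m"
        using i by linarith
      then have "(if 0 < i then s i else 0) = s i" "(if Suc i < ?m then s (Suc i) else 0) = s (Suc i)"
        using ends by auto
      then show ?thesis
        unfolding caterpillar_spine_star_sum[OF i] x_spine using x_leaf by simp
    qed
    also have "s i + s (Suc i) = ?M i * ?d i * (?b + 2) / (?d i + 2)"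
      using d[OF i] unfolding spine_mean_def by (simp add: divide_simps) (simp add: algebra_simps)
    also have "\<dots> + real (a ! i) * (?M i * ?d i / (?d i + 2)) = ?M i * ?d i"
      by (simp add: divide_simps) (simp add: algebra_simps)
    finally show ?thesis .
  qed
  have spine_eq: "(\<Sum>z\<in>{(i, 0), (Suc i, 0)}. (star_sum ?T x z - 2 * s (Suc i)) / vertex_degree ?T z) = 0"
    if i: "Suc i < ?m" for i
  proof -
    have "left_load ?m (\<lambda>i. a ! i) s (Suc i) + right_load ?m (\<lambda>i. a ! i) s (Suc i) = 0"
      using null i by (simp add: spine_null_def)
    moreover have "(star_sum ?T x (k, 0) - 2 * s (Suc i)) / vertex_degree ?T (k, 0) = ?M k - 2 * s (Suc i) / ?d k"
      if "k < ?m" for k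
      unfolding star[OF that] caterpillar_spine_degree[OF that] using d[OF that]
      by (simp add: diff_divide_distrib)
    ultimately show ?thesis
      using i by (simp add: left_load_def right_load_def)
  qed
  have "x e > 0 \<and> (\<Sum>z\<in>e. (star_sum ?T x z - 2 * x e) / vertex_degree ?T z) = 0" if "e \<in> edges ?T" for e
  proof -
    from that consider i where "e = {(i, 0), (Suc i, 0)}" "Suc i < ?m"
      | i j where "e = {(i, 0), (i, j)}" "i < ?m" "1 \<le> j" "j \<le> a ! i"
      unfolding caterpillar_tree_sel by blast
    then show ?thesis
    proof cases
      case 1
      then show ?thesis
        using spine_eq s_pos x_spine(2) by simp
    next
      case 2
      have "x {(i, 0), (i, j)} > 0"
        unfolding x_leaf[OF 2(3)] using M_pos[OF 2(2)] d[OF 2(2)] by simp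
      moreover have "star_sum ?T x (i, 0) = real (spine_nbrs ?m i + a ! i + 2) * x {(i, 0), (i, j)}"
        unfolding star[OF 2(2)] x_leaf[OF 2(3)] by (simp add: divide_simps)
      ultimately show ?thesis
        unfolding 2(1) using caterpillar_leaf_equation[OF 2(2-4)] by blast
    qed
  qed
  then show ?thesis
    unfolding pos_ricci_null_def by blast
qed

text \<open>All edges of a star would carry the star sum divided by \<open>n + 2\<close>, adding up
  to less than the star sum. Order 1 is treated apart because the reduction to the spine relies on
  every spine vertex having a spine neighbour.\<close>

lemma star_no_ricci_null:
  assumes "n \<ge> 1"
  shows "\<not> pos_ricci_null (caterpillar_tree [n]) x"
proof
  let ?T = "caterpillar_tree [n]"
  assume null: "pos_ricci_null ?T x"
  let ?S = "star_sum ?T x (0, 0)"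
  have edge: "{(0, 0), (0, j)} \<in> edges ?T" if "j \<in> {1..n}" for j
    using that by (auto simp: caterpillar_tree_sel)
  have "?S = (\<Sum>j = 1..n. x {(0, 0), (0, j)})"
    using caterpillar_spine_star_sum[of 0 "[n]" x] by simp
  moreover have "(\<Sum>j = 1..n. x {(0, 0), (0, j)}) > 0"
    using assms null edge by (intro sum_pos) (auto simp: pos_ricci_null_def)
  moreover have "x {(0, 0), (0, j)} = ?S / (real n + 2)" if "j \<in> {1..n}" for j
    using null edge[OF that] that caterpillar_leaf_equation[of 0 "[n]" j x]
    by (auto simp: pos_ricci_null_def spine_nbrs_def divide_simps mult.commute)
  then have "(\<Sum>j = 1..n. x {(0, 0), (0, j)}) = real n * (?S / (real n + 2))"
    by simp
  ultimately show False
    by (simp add: divide_simps)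
qed

section \<open>Loads along the spine\<close>

text \<open>Together with the balance of loads, for \<open>a i = 0\<close> these say that the load
  passes through unchanged and the value drops by twice the load.\<close>

lemma interior_loads:
  assumes "0 < i" "Suc i < m"
  shows "4 * (real (a i) + 2) * right_load m a s i = (real (a i) - 4) * s i + (real (a i) + 4) * s (Suc i)"
    and "4 * (real (a i) + 2) * left_load m a s (Suc i) = (real (a i) + 4) * s i + (real (a i) - 4) * s (Suc i)"
proof -
  have b: "spine_nbrs m i = 2"
    using assms by (simp add: spine_nbrs_def)
  show "4 * (real (a i) + 2) * right_load m a s i = (real (a i) - 4) * s i + (real (a i) + 4) * s (Suc i)"
    unfolding right_load_def spine_mean_def b by (simp add: divide_simps) (simp add: algebra_simps)
  show "4 * (real (a i) + 2) * left_load m a s (Suc i) = (real (a i) + 4) * s i + (real (a i) - 4) * s (Suc i)"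
    unfolding left_load_def spine_mean_def diff_Suc_1 b by (simp add: divide_simps) (simp add: algebra_simps)
qed

text \<open>Three leaves are the neutral number at an end: fewer make the load negative, more make
  it positive.\<close>

lemma end_load:
  assumes "m \<ge> 2" "s 0 = 0"
  shows "3 * (real (a 0) + 1) * left_load m a s 1 = (real (a 0) - 3) * s 1"
proof -
  have b: "spine_nbrs m 0 = 1"
    using assms by (simp add: spine_nbrs_def)
  define d where "d = real (a 0) + 1"
  have d: "d > 0"
    by (simp add: d_def)
  have "left_load m a s 1 = (d + 2) / (d * 3) * s 1 - 2 * s 1 / d"
    using assms(2) by (simp add: left_load_def spine_mean_def b d_def add_ac)
  moreover have "3 * d * ((d + 2) / (d * 3) * s 1) = (d + 2) * s 1" "3 * d * (2 * s 1 / d) = 6 * s 1"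
    using d by simp_all
  ultimately have "3 * d * left_load m a s 1 = (d + 2) * s 1 - 6 * s 1"
    by (simp only: right_diff_distrib)
  then show ?thesis
    by (simp add: d_def algebra_simps)
qed

text \<open>A load \<open>- s i / n\<close> with odd \<open>n\<close> can only come from a path ending in one or two leaves; every
  other load is nonnegative.\<close>

definition bare_end :: "nat \<Rightarrow> nat \<Rightarrow> nat \<Rightarrow> bool" where
  "bare_end c i n \<longleftrightarrow> c = 1 \<and> n = 2 * i + 1 \<or> c = 2 \<and> n = 2 * i + 7"

lemma load_lower_bound:
  fixes x t n :: real
  assumes "x * n = - t" "n \<ge> 3" "t > 0"
  shows "3 * x \<ge> - t"
proof -
  have "x * n < 0"
    using assms by simp
  then have "x < 0"
    using assms(2) by (simp add: mult_less_0_iff)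
  then have "x * n \<le> x * 3"
    using assms(2) by (intro mult_left_mono_neg) auto
  with assms(1) show ?thesis
    by linarith
qed

text \<open>At a vertex without leaves the load persists while the value grows by the factor
  \<open>(n + 2) / n\<close>, so \<open>n\<close> rises by 2. At a vertex with leaves only the lower
  bound by a third of the value is used, and it already forces the next load to be
  nonnegative.\<close>

lemma left_load_step:
  assumes i: "0 < i" "Suc i < m" and s: "s i > 0" "s (Suc i) > 0"
    and flow: "right_load m a s i = - left_load m a s i"
    and prev: "left_load m a s i \<ge> 0 \<or>
      (\<exists>n. bare_end (a 0) i n \<and> left_load m a s i * real n = - s i \<and> (\<forall>j. 0 < j \<and> j < i \<longrightarrow> a j = 0))"
  shows "left_load m a s (Suc i) \<ge> 0 \<or>
      (\<exists>n. bare_end (a 0) (Suc i) n \<and> left_load m a s (Suc i) * real n = - s (Suc i) \<and>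
        (\<forall>j. 0 < j \<and> j < Suc i \<longrightarrow> a j = 0))"
proof (cases "a i = 0")
  case True
  then have step: "left_load m a s (Suc i) = left_load m a s i" "s (Suc i) = s i - 2 * left_load m a s i"
    using interior_loads[OF i, of a s] flow by (simp_all add: algebra_simps)
  from prev show ?thesis
  proof (elim disjE exE conjE)
    fix n assume n: "bare_end (a 0) i n" "left_load m a s i * real n = - s i" "\<forall>j. 0 < j \<and> j < i \<longrightarrow> a j = 0"
    have "bare_end (a 0) (Suc i) (n + 2)"
      using n(1) by (auto simp: bare_end_def)
    moreover have "left_load m a s (Suc i) * real (n + 2) = - s (Suc i)"
      using n(2) step by (simp add: algebra_simps)
    moreover have "\<forall>j. 0 < j \<and> j < Suc i \<longrightarrow> a j = 0"
      using n(3) True by (auto simp: less_Suc_eq)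
    ultimately show ?thesis
      by blast
  qed (use step in simp)
next
  case False
  define A where "A = real (a i)"
  note I = interior_loads[OF i, of a s, unfolded flow, folded A_def]
  have A: "A \<ge> 1"
    using False by (simp add: A_def)
  have "3 * left_load m a s i \<ge> - s i"
    using prev
  proof (elim disjE exE conjE)
    fix n assume n: "bare_end (a 0) i n" "left_load m a s i * real n = - s i"
    have "real n \<ge> 3"
      using n(1) i by (auto simp: bare_end_def)
    with n(2) s show ?thesis
      by (intro load_lower_bound)
  qed (use s in simp)
  then have "(A + 2) * (3 * left_load m a s i) \<ge> (A + 2) * (- s i)"
    using A by (intro mult_left_mono) auto
  \<comment> \<open>The balance at edge \<open>i\<close> limits how far the value can rise across
    the vertex, and thereby the negative part of the next load.\<close>
  then have bound: "3 * (A + 4) * s (Suc i) \<le> (20 + A) * s i"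
    using I(1) by (simp add: algebra_simps)
  have "(A + 4) * s i + (A - 4) * s (Suc i) \<ge> 0"
  proof (cases "A \<ge> 4")
    case True
    then show ?thesis
      using A s by simp
  next
    case False
    have "3 * (A + 4) * ((4 - A) * s (Suc i)) = (4 - A) * (3 * (A + 4) * s (Suc i))"
      by (simp only: mult_ac)
    also have "\<dots> \<le> (4 - A) * ((20 + A) * s i)"
      using bound False by (intro mult_left_mono) auto
    also have "\<dots> = ((4 - A) * (20 + A)) * s i"
      by (simp only: mult_ac)
    \<comment> \<open>This comparison of coefficients holds from \<open>A = 1\<close> on and fails
      at \<open>A = 0\<close>, where a load is passed on with its sign.\<close>
    also have "\<dots> \<le> (3 * (A + 4) * (A + 4)) * s i"
    proof (rule mult_right_mono)
      have "A * A \<ge> 1"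
        using A mult_mono[of 1 A 1 A] by simp
      then show "(4 - A) * (20 + A) \<le> 3 * (A + 4) * (A + 4)"
        using A by (simp add: algebra_simps)
    qed (use s in simp)
    also have "\<dots> = 3 * (A + 4) * ((A + 4) * s i)"
      by (simp only: mult_ac)
    finally have "(4 - A) * s (Suc i) \<le> (A + 4) * s i"
      using A by simp
    then show ?thesis
      by (simp add: algebra_simps)
  qed
  then have "4 * (A + 2) * left_load m a s (Suc i) \<ge> 0"
    using I(2) by simp
  then show ?thesis
    using A by (simp add: zero_le_mult_iff)
qed

lemma left_load_cases:
  assumes m: "m \<ge> 2" and null: "spine_null m a s" and a0: "a 0 \<ge> 1" and i: "0 < i" "i < m"
  shows "left_load m a s i \<ge> 0 \<or>
    (\<exists>n. bare_end (a 0) i n \<and> left_load m a s i * real n = - s i \<and> (\<forall>j. 0 < j \<and> j < i \<longrightarrow> a j = 0))"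
  using i
proof (induction i)
  case (Suc i)
  show ?case
  proof (cases "i = 0")
    case True
    have s1: "s 1 > 0" "s 0 = 0"
      using m null by (auto simp: spine_null_def)
    note E = end_load[where s = s and a = a, OF m s1(2)]
    consider "a 0 = 1" | "a 0 = 2" | "a 0 \<ge> 3"
      using a0 by linarith
    then show ?thesis
    proof cases
      case 3
      then have "3 * (real (a 0) + 1) * left_load m a s 1 \<ge> 0"
        unfolding E using s1 by simp
      then show ?thesis
        using True by (simp add: zero_le_mult_iff)
    qed (use E True in \<open>auto simp: bare_end_def\<close>)
  next
    case False
    then have i: "0 < i" "Suc i < m"
      using Suc by auto
    have s: "s i > 0" "s (Suc i) > 0" and flow: "right_load m a s i = - left_load m a s i"
      using null i by (auto simp: spine_null_def add_eq_0_iff2)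
    show ?thesis
      using left_load_step[OF i s flow] Suc.IH i by simp
  qed
qed simp

text \<open>Reversal sends the vertex \<open>i\<close> to \<open>m - Suc i\<close> but the edge
  \<open>i\<close> to \<open>m - i\<close>, since edge \<open>i\<close> lies between the vertices
  \<open>i - 1\<close> and \<open>i\<close>.\<close>

lemma spine_null_rev:
  assumes "spine_null m a s"
  shows "spine_null m (\<lambda>i. a (m - Suc i)) (\<lambda>i. s (m - i))"
    and "\<And>i. 0 < i \<Longrightarrow> i < m \<Longrightarrow> left_load m (\<lambda>i. a (m - Suc i)) (\<lambda>i. s (m - i)) i = right_load m a s (m - i)"
proof -
  let ?a = "\<lambda>i. a (m - Suc i)" and ?s = "\<lambda>i. s (m - i)"
  have nb: "spine_nbrs m (m - Suc i) = spine_nbrs m i" if "i < m" for i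
    using that by (auto simp: spine_nbrs_def)
  have mean: "spine_mean m ?a ?s i = spine_mean m a s (m - Suc i)" if "i < m" for i
  proof -
    have k: "Suc (m - Suc i) = m - i"
      using that by auto
    show ?thesis
      unfolding spine_mean_def nb[OF that] k by (simp only: add.commute)
  qed
  show L: "left_load m ?a ?s i = right_load m a s (m - i)" if i: "0 < i" "i < m" for i
  proof -
    have k: "m - Suc (i - 1) = m - i" "i - 1 < m"
      using i by auto
    show ?thesis
      unfolding left_load_def right_load_def mean[OF k(2)] nb[OF k(2), symmetric] k(1) ..
  qed
  have R: "right_load m ?a ?s i = left_load m a s (m - i)" if i: "0 < i" "i < m" for i
  proof -
    have k: "m - i - 1 = m - Suc i"
      using i by auto
    show ?thesis
      unfolding left_load_def right_load_def mean[OF i(2)] nb[OF i(2), symmetric] k ..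
  qed
  show "spine_null m ?a ?s"
    using assms unfolding spine_null_def by (auto simp: L R add.commute)
qed

lemma right_load_cases:
  assumes m: "m \<ge> 2" and null: "spine_null m a s" and am: "a (m - 1) \<ge> 1" and i: "0 < i" "i < m"
  shows "right_load m a s i \<ge> 0 \<or>
    (\<exists>n. bare_end (a (m - 1)) (m - i) n \<and> right_load m a s i * real n = - s i \<and>
      (\<forall>j. i \<le> j \<and> j < m - 1 \<longrightarrow> a j = 0))"
proof -
  have i': "0 < m - i" "m - i < m" "m - (m - i) = i"
    using i by auto
  have z: "(\<forall>j. 0 < j \<and> j < m - i \<longrightarrow> a (m - Suc j) = 0) \<longleftrightarrow> (\<forall>j. i \<le> j \<and> j < m - 1 \<longrightarrow> a j = 0)"
    (is "?l \<longleftrightarrow> ?r")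
  proof
    assume l: ?l
    show ?r
    proof (intro allI impI)
      fix j assume "i \<le> j \<and> j < m - 1"
      then have "0 < m - Suc j \<and> m - Suc j < m - i" "m - Suc (m - Suc j) = j"
        using i by auto
      with l show "a j = 0"
        by metis
    qed
  next
    assume r: ?r
    show ?l
    proof (intro allI impI)
      fix j assume "0 < j \<and> j < m - i"
      then have "i \<le> m - Suc j \<and> m - Suc j < m - 1"
        using i by auto
      with r show "a (m - Suc j) = 0"
        by blast
    qed
  qed
  show ?thesis
    using left_load_cases[OF m spine_null_rev(1)[OF null] _ i'(1,2)] am
    unfolding spine_null_rev(2)[OF null i'(1,2)] i'(3) z by auto
qed

section \<open>Spines with leaves at an inner vertex\<close>

lemma branch_load_negative:
  fixes A p q L R :: real
  assumes "A \<ge> 1" "p > 0" "q > 0"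
    and "4 * (A + 2) * L = (4 - A) * p - (A + 4) * q" "4 * (A + 2) * R = (4 - A) * q - (A + 4) * p"
    and "3 * R \<ge> - q"
  shows "L < 0"
proof (rule ccontr)
  assume "\<not> L < 0"
  then have "4 * (A + 2) * L \<ge> 0"
    using assms(1) by simp
  \<comment> \<open>A nonnegative \<open>L\<close> bounds \<open>q\<close> by a multiple of
    \<open>p\<close>, and the bound on \<open>R\<close> below bounds \<open>p\<close> by a multiple
    of \<open>q\<close>. For \<open>A \<ge> 1\<close> the product of the two factors is less than 1,
    by the same quadratic inequality as in \<open>left_load_step\<close>.\<close>
  then have 1: "(A + 4) * q \<le> (4 - A) * p"
    using assms(4) by simp
  have "(A + 4) * q > 0"
    using assms by simp
  with 1 have "(4 - A) * p > 0"
    by linarith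
  then have A: "A < 4"
    using assms(2) by (simp add: zero_less_mult_iff)
  have "(A + 2) * (3 * R) \<ge> (A + 2) * (- q)"
    using assms by (intro mult_left_mono) auto
  then have 2: "3 * (A + 4) * p \<le> (20 + A) * q"
    using assms(5) by (simp add: algebra_simps)
  have "3 * (A + 4) * (A + 4) * q = 3 * (A + 4) * ((A + 4) * q)"
    by simp
  also have "\<dots> \<le> 3 * (A + 4) * ((4 - A) * p)"
    using 1 assms by (intro mult_left_mono) auto
  also have "\<dots> = (4 - A) * (3 * (A + 4) * p)"
    by simp
  also have "\<dots> \<le> (4 - A) * ((20 + A) * q)"
    using 2 A by (intro mult_left_mono) auto
  finally have "(3 * (A + 4) * (A + 4)) * q \<le> ((4 - A) * (20 + A)) * q"
    by (simp add: mult.assoc)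
  then have "3 * (A + 4) * (A + 4) \<le> (4 - A) * (20 + A)"
    using assms(3) by simp
  moreover have "A * A \<ge> 1"
    using assms(1) mult_mono[of 1 A 1 A] by simp
  ultimately show False
    using assms(1) by (simp add: algebra_simps)
qed

text \<open>For \<open>A = 1\<close> the equation becomes
  \<open>(4 * n - 9) * (4 * n' - 9) = 225\<close>, where oddness removes n = n' = 6; for
  \<open>A = 2\<close> it becomes \<open>(n - 1) * (n' - 1) = 9\<close>, which has no odd solution.
  For \<open>A = 3\<close> the value 3 fails by divisibility and values from 5 on are too large; for
  \<open>A = 4\<close> it is \<open>n * n' = 9\<close>.\<close>

lemma branch_equation:
  fixes A n n' :: nat
  assumes A: "A \<ge> 1" and n: "n \<ge> 3" "n' \<ge> 3" "odd n" "odd n'"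
    and eq: "(int A + 4)\<^sup>2 * (int n * int n') =
      ((4 - int A) * int n + 4 * (int A + 2)) * ((4 - int A) * int n' + 4 * (int A + 2))"
    and "A \<le> 4"
  shows "A = 4 \<and> n = 3 \<and> n' = 3 \<or> A = 1 \<and> (n = 3 \<and> n' = 21 \<or> n = 21 \<and> n' = 3)"
proof -
  define x y where "x = int n" and "y = int n'"
  have xy: "x \<ge> 3" "y \<ge> 3" "odd x" "odd y"
    using n by (auto simp: x_def y_def)
  consider "A = 1" | "A = 2" | "A = 3" | "A = 4"
    using assms by linarith
  then show ?thesis
  proof cases
    case 1
    then have e: "(4 * x - 9) * (4 * y - 9) = 225"
      using eq by (simp add: x_def y_def algebra_simps)
    have small: "u = 3 \<and> v = 21" if "(4 * u - 9) * (4 * v - 9) = 225" "u \<ge> 3" "odd u" "u < 7" for u v :: int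
    proof -
      have "u = 3 \<or> u = 4 \<or> u = 5 \<or> u = 6"
        using that by linarith
      then show ?thesis
      proof (elim disjE)
        assume "u = 5"
        then have "11 * (4 * v - 9) = 225"
          using that by simp
        then show ?thesis
          by presburger
      qed (use that in auto)
    qed
    have "x < 7 \<or> y < 7"
    proof (rule ccontr)
      assume "\<not> (x < 7 \<or> y < 7)"
      then have "19 * 19 \<le> (4 * x - 9) * (4 * y - 9)"
        by (intro mult_mono) auto
      with e show False
        by simp
    qed
    then have "x = 3 \<and> y = 21 \<or> y = 3 \<and> x = 21"
      using small[of x y] small[of y x] e xy by (auto simp: mult.commute)
    with 1 show ?thesis
      by (auto simp: x_def y_def)
  next
    case 2
    then have "(x - 1) * (y - 1) = 9"
      using eq by (simp add: x_def y_def algebra_simps)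
    moreover have "even ((x - 1) * (y - 1))"
      using xy by simp
    ultimately show ?thesis
      by simp
  next
    case 3
    then have e: "12 * (x * y) = 5 * x + 5 * y + 100"
      using eq by (simp add: x_def y_def algebra_simps)
    have small: "u \<noteq> 3" if "12 * (u * v) = 5 * u + 5 * v + 100" for u v :: int
      using that by auto presburger
    then have "x \<noteq> 3" "y \<noteq> 3"
      using e by (metis, metis add.commute mult.commute)
    then have "x \<ge> 5" "y \<ge> 5"
      using xy by presburger+
    then have "(x - 5) * (y - 5) \<ge> 0"
      by simp
    with e \<open>x \<ge> 5\<close> \<open>y \<ge> 5\<close> show ?thesis
      by (simp add: algebra_simps)
  next
    case 4
    then have e: "x * y = 9"
      using eq by (simp add: x_def y_def algebra_simps)
    have "u = 3" if "u * v = 9" "u \<ge> 3" "v \<ge> 3" for u v :: int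
    proof (rule ccontr)
      assume "u \<noteq> 3"
      then have "4 * 3 \<le> u * v"
        using that by (intro mult_mono) auto
      with that show False
        by simp
    qed
    from this[of x y] this[of y x] have "x = 3" "y = 3"
      using e xy by (auto simp: mult.commute)
    with 4 show ?thesis
      by (simp add: x_def y_def)
  qed
qed

text \<open>Both loads next to a vertex with leaves turn out negative, which only bare ends can
  produce. So apart from the two ends no other spine vertex carries leaves.\<close>

lemma spine_null_branch:
  assumes m: "m \<ge> 2" and null: "spine_null m a s" and ends: "a 0 \<ge> 1" "a (m - 1) \<ge> 1"
    and i: "0 < i" "Suc i < m" and ai: "a i \<ge> 1"
  obtains n n' where "bare_end (a 0) i n" "bare_end (a (m - 1)) (m - Suc i) n'"
    "\<forall>j. 0 < j \<and> j < i \<longrightarrow> a j = 0" "\<forall>j. Suc i \<le> j \<and> j < m - 1 \<longrightarrow> a j = 0"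
    "a i = 4 \<and> n = 3 \<and> n' = 3 \<or> a i = 1 \<and> (n = 3 \<and> n' = 21 \<or> n = 21 \<and> n' = 3)"
proof -
  define L R where "L = left_load m a s i" and "R = right_load m a s (Suc i)"
  let ?p = "s i" and ?q = "s (Suc i)" and ?A = "real (a i)"
  have pq: "?p > 0" "?q > 0" "right_load m a s i = - L" "left_load m a s (Suc i) = - R"
    using null i by (auto simp: spine_null_def add_eq_0_iff2 add_eq_0_iff L_def R_def)
  have A: "?A \<ge> 1"
    using ai by simp
  have eqs: "4 * (?A + 2) * L = (4 - ?A) * ?p - (?A + 4) * ?q" "4 * (?A + 2) * R = (4 - ?A) * ?q - (?A + 4) * ?p"
    using interior_loads[OF i, of a s] unfolding pq(3,4) by (simp_all add: algebra_simps)
  have ge: "real n \<ge> 3" if "bare_end c k n" "k > 0" for c k n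
    using that by (auto simp: bare_end_def)
  have lc: "L \<ge> 0 \<or> (\<exists>n. bare_end (a 0) i n \<and> L * real n = - ?p \<and> (\<forall>j. 0 < j \<and> j < i \<longrightarrow> a j = 0))"
    unfolding L_def using i by (intro left_load_cases m null ends) auto
  have rc: "R \<ge> 0 \<or> (\<exists>n. bare_end (a (m - 1)) (m - Suc i) n \<and> R * real n = - ?q \<and> (\<forall>j. Suc i \<le> j \<and> j < m - 1 \<longrightarrow> a j = 0))"
    unfolding R_def using i by (intro right_load_cases m null ends) auto
  \<comment> \<open>The bound by one third on either side forces the load of the other side to be
    negative.\<close>
  have "3 * L \<ge> - ?p"
    using lc load_lower_bound[of L] ge pq(1) i by fastforce
  then have "R < 0"
    by (intro branch_load_negative[OF A pq(2,1) eqs(2,1)])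
  have "3 * R \<ge> - ?q"
    using rc load_lower_bound[of R] ge pq(2) i by fastforce
  then have "L < 0"
    by (intro branch_load_negative[OF A pq(1,2) eqs])
  obtain n where n: "bare_end (a 0) i n" "L * real n = - ?p" "\<forall>j. 0 < j \<and> j < i \<longrightarrow> a j = 0"
    using lc \<open>L < 0\<close> by auto
  obtain n' where n': "bare_end (a (m - 1)) (m - Suc i) n'" "R * real n' = - ?q" "\<forall>j. Suc i \<le> j \<and> j < m - 1 \<longrightarrow> a j = 0"
    using rc \<open>R < 0\<close> by auto
  have n3: "n \<ge> 3" "n' \<ge> 3" "odd n" "odd n'"
    using n(1) n'(1) i by (auto simp: bare_end_def)
  define F where "F k = (4 - ?A) * real k + 4 * (?A + 2)" for k :: nat
  have F: "(?A + 4) * real n * ?q = F n * ?p" "(?A + 4) * real n' * ?p = F n' * ?q"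
  proof -
    have "4 * (?A + 2) * (L * real n) = real n * ((4 - ?A) * ?p - (?A + 4) * ?q)"
      "4 * (?A + 2) * (R * real n') = real n' * ((4 - ?A) * ?q - (?A + 4) * ?p)"
      unfolding eqs[symmetric] by simp_all
    then show "(?A + 4) * real n * ?q = F n * ?p" "(?A + 4) * real n' * ?p = F n' * ?q"
      unfolding n(2) n'(2) F_def by (simp_all add: algebra_simps)
  qed
  \<comment> \<open>Multiplying the two proportions allows \<open>?p * ?q\<close> to be cancelled
    and leaves an equation between integers.\<close>
  have "((?A + 4) * real n * ?q) * ((?A + 4) * real n' * ?p) = (F n * ?p) * (F n' * ?q)"
    unfolding F ..
  then have "((?A + 4)\<^sup>2 * (real n * real n')) * (?p * ?q) = (F n * F n') * (?p * ?q)"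
    by (simp add: power2_eq_square mult_ac)
  then have "(?A + 4)\<^sup>2 * (real n * real n') = F n * F n'"
    using pq by simp
  then have "real_of_int ((int (a i) + 4)\<^sup>2 * (int n * int n')) =
      real_of_int (((4 - int (a i)) * int n + 4 * (int (a i) + 2)) * ((4 - int (a i)) * int n' + 4 * (int (a i) + 2)))"
    by (simp add: F_def)
  then have eq: "(int (a i) + 4)\<^sup>2 * (int n * int n') =
      ((4 - int (a i)) * int n + 4 * (int (a i) + 2)) * ((4 - int (a i)) * int n' + 4 * (int (a i) + 2))"
    by (simp only: of_int_eq_iff)
  have "a i \<le> 4"
  proof (rule ccontr)
    assume "\<not> a i \<le> 4"
    then have A5: "?A \<ge> 5"
      by simp
    \<comment> \<open>From five leaves on, the first proportion gives \<open>?q < ?p\<close> and the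
      second \<open>?p < ?q\<close>.\<close>
    have Flt: "F k < (?A + 4) * real k" if "k \<ge> 3" for k
    proof -
      have "2 * ?A * 3 \<le> 2 * ?A * real k"
        using that A by (intro mult_left_mono) auto
      then have "8 + 4 * ?A < 2 * ?A * real k"
        using A5 by linarith
      then show ?thesis
        by (simp add: F_def algebra_simps)
    qed
    have lt: "v < u" if "(?A + 4) * real k * v = F k * u" "k \<ge> 3" "u > 0" for u v k
    proof -
      have "(?A + 4) * real k * v < (?A + 4) * real k * u"
        unfolding that(1) using Flt[OF that(2)] that(3) by (rule mult_strict_right_mono)
      moreover have "(?A + 4) * real k > 0"
        using that A by simp
      ultimately show ?thesis
        by (simp only: mult_less_cancel_left_pos)
    qed
    show False
      using lt[OF F(1) n3(1) pq(1)] lt[OF F(2) n3(2) pq(2)] by simp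
  qed
  from that[OF n(1) n'(1) n(3) n'(3)] branch_equation[OF ai n3 eq this] show thesis
    by blast
qed

section \<open>Spines with leaves at the two ends only\<close>

lemma no_branch_equation:
  fixes \<alpha> \<beta> k :: nat
  assumes "\<alpha> \<ge> 1" "\<beta> \<ge> 1"
    and eq: "(int \<beta> - 3) * (3 * (int \<alpha> + 1) - 2 * int k * (int \<alpha> - 3)) = - 3 * (int \<beta> + 1) * (int \<alpha> - 3)"
    and pos: "3 * (int \<alpha> + 1) - 2 * int k * (int \<alpha> - 3) > 0"
  shows "(\<alpha>, \<beta>) = (3, 3) \<or>
    (\<alpha>, k, \<beta>) \<in> {(1, 1, 9), (1, 2, 6), (1, 3, 5), (1, 6, 4), (2, 0, 5), (2, 3, 4)} \<or>
    (\<beta>, k, \<alpha>) \<in> {(1, 1, 9), (1, 2, 6), (1, 3, 5), (1, 6, 4), (2, 0, 5), (2, 3, 4)}"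
proof -
  define A B where "A = int \<alpha> - 3" and "B = int \<beta> - 3"
  have AB: "A \<ge> - 2" "B \<ge> - 2"
    using assms by (auto simp: A_def B_def)
  \<comment> \<open>For nonzero \<open>A\<close> and \<open>B\<close> this reads
    \<open>k = 3 + 6 / A + 6 / B\<close>. It has solutions with \<open>A\<close> and
    \<open>B\<close> both positive, such as \<open>A = B = 6\<close> with \<open>k = 5\<close>. They
    are excluded by \<open>pos\<close>, the positivity of the last spine value, which through
    \<open>sgn\<close> forces opposite signs; what remains are the divisors of 6.\<close>
  have eq': "3 * (A * B) + 6 * A + 6 * B = int k * (A * B)"
    using eq by (simp add: A_def B_def algebra_simps)
  have sgn: "B * (3 * (int \<alpha> + 1) - 2 * int k * A) = - 3 * (int \<beta> + 1) * A"
    using eq by (simp add: A_def B_def)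
  have six: "(u, v) \<in> {(1, 6), (2, 3), (3, 2), (6, 1)}" if uv: "u * v = 6" for u v :: nat
  proof -
    have "u dvd 6"
      using uv by (metis dvd_triv_left)
    then have "u \<le> 6" "u > 0"
      by (auto dest: dvd_imp_le intro: ccontr)
    then have "u = 1 \<or> u = 2 \<or> u = 3 \<or> u = 4 \<or> u = 5 \<or> u = 6"
      by linarith
    with uv show ?thesis
      by (elim disjE) (auto, presburger+)
  qed
  have key: "(c, k, d) \<in> {(1, 1, 9), (1, 2, 6), (1, 3, 5), (1, 6, 4), (2, 0, 5), (2, 3, 4)}"
    if cd: "C = int c - 3" "D = int d - 3" "c \<ge> 1" "C < 0" "D > 0" "3 * (C * D) + 6 * C + 6 * D = int k * (C * D)" for C D c d
  proof -
    obtain e where e: "d = e + 3" "D = int e"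
    proof
      show "d = (d - 3) + 3" "D = int (d - 3)"
        using cd(2,5) by auto
    qed
    consider "c = 1" | "c = 2"
      using cd by linarith
    then show ?thesis
    proof cases
      case 1
      then have "int (k * e) = int 6"
        using cd e by (simp add: algebra_simps)
      then have "k * e = 6"
        by (simp only: of_nat_eq_iff)
      from six[OF this] 1 e show ?thesis
        by auto
    next
      case 2
      then have "int ((k + 3) * e) = int 6"
        using cd e by (simp add: algebra_simps)
      then have "(k + 3) * e = 6"
        by (simp only: of_nat_eq_iff)
      from six[OF this] 2 e show ?thesis
        by auto
    qed
  qed
  consider "A = 0" | "A < 0" | "A > 0"
    by linarith
  then show ?thesis
  proof cases
    case 1
    then have "B = 0"
      using eq' by simp
    with 1 show ?thesis
      by (simp add: A_def B_def)
  next
    case 2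
    have "B * (3 * (int \<alpha> + 1) - 2 * int k * A) > 0"
      using 2 mult_pos_neg[of "3 * (int \<beta> + 1)" A] unfolding sgn by (simp add: algebra_simps)
    then have "B > 0"
      using pos by (simp add: zero_less_mult_iff A_def)
    from key[OF A_def B_def assms(1) 2 this eq'] show ?thesis
      by (rule disjI2[OF disjI1])
  next
    case 3
    have "B * (3 * (int \<alpha> + 1) - 2 * int k * A) < 0"
      using 3 mult_pos_pos[of "3 * (int \<beta> + 1)" A] unfolding sgn by (simp add: algebra_simps)
    then have B: "B < 0"
      using pos by (simp add: mult_less_0_iff A_def)
    have "3 * (B * A) + 6 * B + 6 * A = int k * (B * A)"
      using eq' by (simp add: mult.commute)
    from key[OF B_def A_def assms(2) B 3 this] show ?thesis
      by (rule disjI2[OF disjI2])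
  qed
qed

text \<open>Without inner leaves the load has one value \<open>g\<close> along the whole spine and
  the edge values form an arithmetic progression. The two end conditions then leave a single
  equation between the leaf numbers and the number \<open>m - 2\<close> of inner vertices.\<close>

lemma spine_null_no_branch:
  assumes m: "m \<ge> 2" and null: "spine_null m a s" and ends: "a 0 \<ge> 1" "a (m - 1) \<ge> 1"
    and zero: "\<And>i. 0 < i \<Longrightarrow> Suc i < m \<Longrightarrow> a i = 0"
  shows "(a 0, a (m - 1)) = (3, 3) \<or>
    (a 0, m - 2, a (m - 1)) \<in> {(1, 1, 9), (1, 2, 6), (1, 3, 5), (1, 6, 4), (2, 0, 5), (2, 3, 4)} \<or>
    (a (m - 1), m - 2, a 0) \<in> {(1, 1, 9), (1, 2, 6), (1, 3, 5), (1, 6, 4), (2, 0, 5), (2, 3, 4)}"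
proof -
  define g where "g = left_load m a s 1"
  have s: "s i > 0" "right_load m a s i = - left_load m a s i" if "0 < i" "i < m" for i
    using null that by (auto simp: spine_null_def add_eq_0_iff2)
  have lin: "Suc i < m \<longrightarrow> left_load m a s (Suc i) = g \<and> s (Suc i) = s 1 - 2 * g * real i" for i
  proof (induction i)
    case (Suc i)
    show ?case
    proof
      assume i: "Suc (Suc i) < m"
      then have "left_load m a s (Suc i) = g" "s (Suc i) = s 1 - 2 * g * real i"
        using Suc by auto
      then show "left_load m a s (Suc (Suc i)) = g \<and> s (Suc (Suc i)) = s 1 - 2 * g * real (Suc i)"
        using interior_loads[of "Suc i" m a s] i s(2)[of "Suc i"] zero[of "Suc i"] by (simp add: algebra_simps)
    qed
  qed (simp add: g_def)
  let ?\<alpha> = "real (a 0)" and ?\<beta> = "real (a (m - 1))" and ?k = "real (m - 2)"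
  have m': "0 < m - 1" "m - 1 < m" "Suc (m - 2) = m - 1"
    using m by auto
  have last: "left_load m a s (m - 1) = g" "s (m - 1) = s 1 - 2 * g * ?k"
    using lin[of "m - 2"] m' by auto
  have s0: "s 0 = 0" "s m = 0"
    using null by (auto simp: spine_null_def)
  have E0: "3 * (?\<alpha> + 1) * g = (?\<alpha> - 3) * s 1"
    unfolding g_def by (rule end_load[where s = s, OF m s0(1)])
  \<comment> \<open>The condition at the right end is the one at the left end of the reversed
    spine.\<close>
  have "3 * (?\<beta> + 1) * right_load m a s (m - 1) = (?\<beta> - 3) * s (m - 1)"
    using end_load[where s = "\<lambda>i. s (m - i)" and a = "\<lambda>i. a (m - Suc i)", OF m] s0
      spine_null_rev(2)[OF null, of 1] m by simp
  then have E1: "(?\<beta> - 3) * s (m - 1) = - 3 * (?\<beta> + 1) * g"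
    using s(2)[OF m'(1,2)] last(1) by (simp add: algebra_simps)
  have sm: "3 * (?\<alpha> + 1) * s (m - 1) = (3 * (?\<alpha> + 1) - 2 * ?k * (?\<alpha> - 3)) * s 1"
  proof -
    have "3 * (?\<alpha> + 1) * s (m - 1) = 3 * (?\<alpha> + 1) * s 1 - 2 * ?k * (3 * (?\<alpha> + 1) * g)"
      unfolding last by (simp add: algebra_simps)
    then show ?thesis
      unfolding E0 by (simp add: algebra_simps)
  qed
  have s1: "s 1 > 0"
    using s m by simp
  have "3 * (?\<alpha> + 1) * s (m - 1) > 0"
    using s(1)[OF m'(1,2)] by simp
  then have pos: "3 * (?\<alpha> + 1) - 2 * ?k * (?\<alpha> - 3) > 0"
    using s1 unfolding sm by (simp add: zero_less_mult_iff)
  have "(?\<beta> - 3) * (3 * (?\<alpha> + 1) * s (m - 1)) = - 3 * (?\<beta> + 1) * (3 * (?\<alpha> + 1) * g)"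
    using arg_cong[OF E1, of "\<lambda>t. 3 * (?\<alpha> + 1) * t"] by (simp only: mult_ac)
  then have "((?\<beta> - 3) * (3 * (?\<alpha> + 1) - 2 * ?k * (?\<alpha> - 3))) * s 1 = (- 3 * (?\<beta> + 1) * (?\<alpha> - 3)) * s 1"
    unfolding sm E0 by (simp only: mult.assoc)
  then have eq: "(?\<beta> - 3) * (3 * (?\<alpha> + 1) - 2 * ?k * (?\<alpha> - 3)) = - 3 * (?\<beta> + 1) * (?\<alpha> - 3)"
    using s1 by simp
  let ?ia = "int (a 0)" and ?ib = "int (a (m - 1))" and ?ik = "int (m - 2)"
  have "real_of_int ((?ib - 3) * (3 * (?ia + 1) - 2 * ?ik * (?ia - 3))) = real_of_int (- 3 * (?ib + 1) * (?ia - 3))"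
    "real_of_int (3 * (?ia + 1) - 2 * ?ik * (?ia - 3)) > 0"
    using eq pos by (simp_all add: algebra_simps)
  then have "(?ib - 3) * (3 * (?ia + 1) - 2 * ?ik * (?ia - 3)) = - 3 * (?ib + 1) * (?ia - 3)"
    "3 * (?ia + 1) - 2 * ?ik * (?ia - 3) > 0"
    by (simp_all only: of_int_eq_iff of_int_0_less_iff)
  then show ?thesis
    by (rule no_branch_equation[OF ends])
qed

section \<open>From the Diophantine solutions to the list of sequences\<close>

lemma bare_end_cases:
  assumes "bare_end c i n"
  shows "n = 3 \<Longrightarrow> i > 0 \<Longrightarrow> c = 1 \<and> i = 1" "n = 21 \<Longrightarrow> c = 1 \<and> i = 10 \<or> c = 2 \<and> i = 7"
  using assms by (auto simp: bare_end_def)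

lemma list_eq_Cons_replicate:
  assumes "length a = k + 2" "\<And>j. 0 < j \<Longrightarrow> Suc j < length a \<Longrightarrow> a ! j = c"
  shows "a = [a ! 0] @ replicate k c @ [a ! (length a - 1)]"
proof (rule nth_equalityI)
  fix j assume "j < length a"
  then consider "j = 0" | "0 < j" "j < k + 1" | "j = k + 1"
    using assms(1) by linarith
  then show "a ! j = ([a ! 0] @ replicate k c @ [a ! (length a - 1)]) ! j"
    using assms by cases (auto simp: nth_append nth_Cons')
qed (use assms in simp)

lemma spine_null_classification:
  assumes m: "length a \<ge> 2" and ends: "hd a \<ge> 1" "last a \<ge> 1" and null: "spine_null (length a) (\<lambda>i. a ! i) s"
  shows "(\<exists>m\<ge>2. a = [3] @ replicate (m - 2) 0 @ [3]) \<or> a \<in> sporadic_sequences \<or> rev a \<in> sporadic_sequences"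
proof -
  let ?m = "length a"
  have "a \<noteq> []"
    using m by auto
  then have ends': "a ! 0 \<ge> 1" "a ! (?m - 1) \<ge> 1"
    using ends by (simp_all add: hd_conv_nth last_conv_nth)
  show ?thesis
  proof (cases "\<exists>i. 0 < i \<and> Suc i < ?m \<and> a ! i \<ge> 1")
    case False
    then have zero: "a ! i = 0" if "0 < i" "Suc i < ?m" for i
      using False that by (metis less_one not_less)
    have a: "a = [a ! 0] @ replicate (?m - 2) 0 @ [a ! (?m - 1)]"
      by (rule list_eq_Cons_replicate) (use m zero in auto)
    define \<alpha> \<beta> k where "\<alpha> = a ! 0" and "\<beta> = a ! (?m - 1)" and "k = ?m - 2"
    let ?X = "{(1, 1, 9), (1, 2, 6), (1, 3, 5), (1, 6, 4), (2, 0, 5), (2, 3, 4)} :: (nat \<times> nat \<times> nat) set"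
    have X: "c # replicate l 0 @ [d] \<in> sporadic_sequences" if "(c, l, d) \<in> ?X" for c l d
      using that by (elim insertE emptyE) (simp_all add: sporadic_sequences_def eval_nat_numeral)
    have a': "a = \<alpha> # replicate k 0 @ [\<beta>]"
      using a by (simp add: \<alpha>_def \<beta>_def k_def)
    have "(\<alpha>, \<beta>) = (3, 3) \<or> (\<alpha>, k, \<beta>) \<in> ?X \<or> (\<beta>, k, \<alpha>) \<in> ?X"
      unfolding \<alpha>_def \<beta>_def k_def by (rule spine_null_no_branch[OF m null ends' zero])
    then show ?thesis
    proof (elim disjE)
      assume "(\<alpha>, \<beta>) = (3, 3)"
      then have "a = [3] @ replicate (k + 2 - 2) 0 @ [3]"
        using a' by simp
      then show ?thesis
        by (intro disjI1 exI[of _ "k + 2"]) simp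
    next
      assume "(\<alpha>, k, \<beta>) \<in> ?X"
      from X[OF this] show ?thesis
        unfolding a' by (intro disjI2 disjI1)
    next
      assume "(\<beta>, k, \<alpha>) \<in> ?X"
      from X[OF this] have "rev a \<in> sporadic_sequences"
        by (simp add: a')
      then show ?thesis
        by (intro disjI2)
    qed
  next
    case True
    then obtain i where i: "0 < i" "Suc i < ?m" "a ! i \<ge> 1"
      by blast
    obtain n n' where n: "bare_end (a ! 0) i n" "bare_end (a ! (?m - 1)) (?m - Suc i) n'"
      and z: "\<forall>j. 0 < j \<and> j < i \<longrightarrow> a ! j = 0" "\<forall>j. Suc i \<le> j \<and> j < ?m - 1 \<longrightarrow> a ! j = 0"
      and sol: "a ! i = 4 \<and> n = 3 \<and> n' = 3 \<or> a ! i = 1 \<and> (n = 3 \<and> n' = 21 \<or> n = 21 \<and> n' = 3)"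
      using spine_null_branch[OF m null ends' i] by blast
    have left: "n = 3 \<Longrightarrow> a ! 0 = 1 \<and> i = 1" "n = 21 \<Longrightarrow> a ! 0 = 1 \<and> i = 10 \<or> a ! 0 = 2 \<and> i = 7"
      using bare_end_cases[OF n(1)] i by auto
    have right: "n' = 3 \<Longrightarrow> a ! (?m - 1) = 1 \<and> ?m = i + 2"
      "n' = 21 \<Longrightarrow> a ! (?m - 1) = 1 \<and> ?m = i + 11 \<or> a ! (?m - 1) = 2 \<and> ?m = i + 8"
      using bare_end_cases[OF n(2)] i by auto
    \<comment> \<open>The value 21 arises from one leaf at distance 10 or from two leaves at
      distance 7, which accounts for the orders 12 and 9.\<close>
    consider "a ! i = 4" "a ! 0 = 1" "i = 1" "a ! (?m - 1) = 1" "?m = 3"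
      | "a ! i = 1" "a ! 0 = 1" "i = 1" "a ! (?m - 1) = 1" "?m = 12"
      | "a ! i = 1" "a ! 0 = 1" "i = 1" "a ! (?m - 1) = 2" "?m = 9"
      | "a ! i = 1" "a ! 0 = 1" "i = 10" "a ! (?m - 1) = 1" "?m = 12"
      | "a ! i = 1" "a ! 0 = 2" "i = 7" "a ! (?m - 1) = 1" "?m = 9"
    proof -
      from sol have "n = 3 \<and> n' = 3 \<and> a ! i = 4 \<or> n = 3 \<and> n' = 21 \<and> a ! i = 1 \<or> n = 21 \<and> n' = 3 \<and> a ! i = 1"
        by blast
      then show thesis
      proof (elim disjE conjE)
        assume "n = 3" "n' = 3" "a ! i = 4"
        with left(1) right(1) show thesis
          by (intro that(1)) auto
      next
        assume "n = 3" "n' = 21" "a ! i = 1"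
        with left(1) right(2) that(2,3) show thesis
          by fastforce
      next
        assume "n = 21" "n' = 3" "a ! i = 1"
        with left(2) right(1) that(4,5) show thesis
          by fastforce
      qed
    qed
    then show ?thesis
    proof cases
      case 1
      then have "a = [1, 4, 1]"
        by (auto simp: list_eq_iff_nth_eq less_Suc_eq numeral_eq_Suc)
      then show ?thesis
        by (simp add: sporadic_sequences_def)
    next
      case 2
      then have "a = [1, 1, 0, 0, 0, 0, 0, 0, 0, 0, 0, 1]"
        using z by (auto simp: list_eq_iff_nth_eq less_Suc_eq numeral_eq_Suc)
      then show ?thesis
        by (simp add: sporadic_sequences_def)
    next
      case 3
      then have "a = [1, 1, 0, 0, 0, 0, 0, 0, 2]"
        using z by (auto simp: list_eq_iff_nth_eq less_Suc_eq numeral_eq_Suc)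
      then show ?thesis
        by (simp add: sporadic_sequences_def)
    next
      case 4
      then have "a = [1, 0, 0, 0, 0, 0, 0, 0, 0, 0, 1, 1]"
        using z by (auto simp: list_eq_iff_nth_eq less_Suc_eq numeral_eq_Suc)
      then show ?thesis
        by (simp add: sporadic_sequences_def)
    next
      case 5
      then have "a = [2, 0, 0, 0, 0, 0, 0, 1, 1]"
        using z by (auto simp: list_eq_iff_nth_eq less_Suc_eq numeral_eq_Suc)
      then show ?thesis
        by (simp add: sporadic_sequences_def)
    qed
  qed
qed

section \<open>Null vectors for the listed sequences\<close>

lemma spine_null_cong:
  assumes "\<And>i. i < m \<Longrightarrow> a i = a' i" "\<And>i. i \<le> m \<Longrightarrow> s i = s' i"
  shows "spine_null m a s \<longleftrightarrow> spine_null m a' s'"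
proof -
  have "left_load m a s i = left_load m a' s' i" "right_load m a s i = right_load m a' s' i" "s i = s' i"
    if "0 < i" "i < m" for i
    using assms that by (simp_all add: left_load_def right_load_def spine_mean_def)
  moreover have "s 0 = s' 0" "s m = s' m"
    using assms(2) by simp_all
  ultimately show ?thesis
    unfolding spine_null_def by (metis (no_types))
qed

text \<open>Ends with three leaves exert no load, so constant values on the spine edges are in
  balance for every length.\<close>

lemma constant_spine_null:
  fixes k :: nat
  defines "a \<equiv> [3] @ replicate k 0 @ [3]"
  shows "\<exists>s. spine_null (length a) (\<lambda>i. a ! i) s"
proof -
  define m where "m = k + 2"
  define s :: "nat \<Rightarrow> real" where "s i = (if 0 < i \<and> i < m then 1 else 0)" for i
  let ?b = "\<lambda>i. if i = 0 \<or> Suc i = m then 3 else 0 :: nat"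
  have left: "left_load m ?b s i = 0" if "0 < i" "i < m" for i
    using that
    by (cases "i = 1") (auto simp: left_load_def spine_mean_def spine_nbrs_def s_def m_def)
  have right: "right_load m ?b s i = 0" if "0 < i" "i < m" for i
    using that
    by (cases "Suc i = m") (auto simp: right_load_def spine_mean_def spine_nbrs_def s_def m_def)
  have "spine_null m ?b s"
    unfolding spine_null_def using left right by (simp add: s_def)
  moreover have "?b i = a ! i" if "i < m" for i
    using that by (auto simp: a_def m_def nth_append nth_Cons')
  ultimately have "spine_null m (\<lambda>i. a ! i) s"
    using spine_null_cong[of m ?b "\<lambda>i. a ! i" s s] by simp
  then show ?thesis
    by (auto simp: a_def m_def)
qed

lemma spine_null_listsI:
  assumes "length a = m" "s ! 0 = 0" "s ! m = 0"
    "list_all (\<lambda>i. s ! i > 0 \<and> left_load m (\<lambda>i. a ! i) (\<lambda>i. s ! i) i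
      + right_load m (\<lambda>i. a ! i) (\<lambda>i. s ! i) i = 0) [1..<m]"
  shows "\<exists>s. spine_null (length a) (\<lambda>i. a ! i) s"
proof -
  have "spine_null m (\<lambda>i. a ! i) (\<lambda>i. s ! i)"
    using assms unfolding spine_null_def list_all_iff by auto
  then show ?thesis
    using assms(1) by blast
qed

lemma sporadic_spine_null:
  assumes "a \<in> sporadic_sequences"
  shows "\<exists>s. spine_null (length a) (\<lambda>i. a ! i) s"
proof -
  note loads = upt_conv_Cons left_load_def right_load_def spine_mean_def spine_nbrs_def
  from assms consider "a = [2, 5]" | "a = [1, 4, 1]" | "a = [1, 0, 9]" | "a = [1, 0, 0, 6]"
    | "a = [2, 0, 0, 0, 4]" | "a = [1, 0, 0, 0, 5]" | "a = [1, 0, 0, 0, 0, 0, 0, 4]"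
    | "a = [1, 1, 0, 0, 0, 0, 0, 0, 2]" | "a = [1, 0, 0, 0, 0, 0, 0, 0, 0, 0, 1, 1]"
    unfolding sporadic_sequences_def by (elim insertE emptyE)
  \<comment> \<open>After the first two cases the witnesses are progressions of step 2, starting at
    3 next to a single leaf and at 9 next to two leaves, where the load is -1. In the last two cases
    such a progression reaches 21 at the inner vertex with a leaf, and 15 is the value that balances
    it on the short side.\<close>
  then show ?thesis
  proof cases
    case 1
    show ?thesis
      unfolding 1 by (rule spine_null_listsI[where m = 2 and s = "[0, 1, 0]"])
        (simp_all add: loads)
  next
    case 2
    show ?thesis
      unfolding 2 by (rule spine_null_listsI[where m = 3 and s = "[0, 1, 1, 0]"])
        (simp_all add: loads)
  next
    case 3
    show ?thesis
      unfolding 3 by (rule spine_null_listsI[where m = 3 and s = "[0, 3, 5, 0]"])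
        (simp_all add: loads)
  next
    case 4
    show ?thesis
      unfolding 4 by (rule spine_null_listsI[where m = 4 and s = "[0, 3, 5, 7, 0]"])
        (simp_all add: loads)
  next
    case 5
    show ?thesis
      unfolding 5 by (rule spine_null_listsI[where m = 5 and s = "[0, 9, 11, 13, 15, 0]"])
        (simp_all add: loads)
  next
    case 6
    show ?thesis
      unfolding 6 by (rule spine_null_listsI[where m = 5 and s = "[0, 3, 5, 7, 9, 0]"])
        (simp_all add: loads)
  next
    case 7
    show ?thesis
      unfolding 7 by (rule spine_null_listsI[where m = 8 and s = "[0, 3, 5, 7, 9, 11, 13, 15, 0]"])
        (simp_all add: loads)
  next
    case 8
    show ?thesis
      unfolding 8 by (rule spine_null_listsI[where m = 9 and s = "[0, 15, 21, 19, 17, 15, 13, 11, 9, 0]"])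
        (simp_all add: loads)
  next
    case 9
    show ?thesis
      unfolding 9 by (rule spine_null_listsI[where m = 12 and s = "[0, 3, 5, 7, 9, 11, 13, 15, 17, 19, 21, 15, 0]"])
        (simp_all add: loads)
  qed
qed

lemma spine_null_rev_list:
  assumes "\<exists>s. spine_null (length (rev a)) (\<lambda>i. rev a ! i) s"
  shows "\<exists>s. spine_null (length a) (\<lambda>i. a ! i) s"
proof -
  obtain s where "spine_null (length a) (\<lambda>i. rev a ! i) s"
    using assms by auto
  from spine_null_rev(1)[OF this]
  have "spine_null (length a) (\<lambda>i. rev a ! (length a - Suc i)) (\<lambda>i. s (length a - i))" .
  moreover have "rev a ! (length a - Suc i) = a ! i" if "i < length a" for i
    using that by (simp add: rev_nth Suc_diff_Suc)
  ultimately show ?thesis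
    using spine_null_cong[of "length a" "\<lambda>i. rev a ! (length a - Suc i)" "\<lambda>i. a ! i"] by blast
qed

section \<open>Trees that are not caterpillars\<close>

lemma caterpillar_tree_adjacent:
  assumes "{(i, j), (i', j')} \<in> edges (caterpillar_tree a)"
  shows "j \<ge> 1 \<Longrightarrow> i' = i \<and> j' = 0"
    and "j = 0 \<Longrightarrow> j' = 0 \<Longrightarrow> i' = Suc i \<or> i = Suc i'"
proof -
  from assms consider k where "{(i, j), (i', j')} = {(k, 0), (Suc k, 0)}"
    | k l where "{(i, j), (i', j')} = {(k, 0), (k, l)}" "l \<ge> 1"
    unfolding caterpillar_tree_sel by blast
  then have *: "(j \<ge> 1 \<longrightarrow> i' = i \<and> j' = 0) \<and> (j = 0 \<longrightarrow> j' = 0 \<longrightarrow> i' = Suc i \<or> i = Suc i')"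
    by cases (auto simp: doubleton_eq_iff)
  show "j \<ge> 1 \<Longrightarrow> i' = i \<and> j' = 0" and "j = 0 \<Longrightarrow> j' = 0 \<Longrightarrow> i' = Suc i \<or> i = Suc i'"
    using * by auto
qed

lemma S32_sel:
  "verts S32 = {0, 1, 2, 3, 4, 5, 6}"
  "edges S32 = {{0, 1}, {0, 2}, {0, 3}, {1, 4}, {2, 5}, {3, 6}}"
  by (simp_all add: S32_def)

lemma simple_S32: "simple_graph S32"
  by (simp add: simple_graph_def S32_sel)

text \<open>The centre and its three neighbours have degree at least 2, so all four would lie on the
  spine, where a vertex has at most two spine neighbours.\<close>

lemma S32_not_isomorphic_caterpillar: "\<not> graph_isomorphic S32 (caterpillar_tree a)"
proof
  let ?C = "caterpillar_tree a"
  assume "graph_isomorphic S32 ?C"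
  then obtain \<phi> where \<phi>: "bij_betw \<phi> (verts S32) (verts ?C)"
    "\<And>x y. x \<in> verts S32 \<Longrightarrow> y \<in> verts S32 \<Longrightarrow> {x, y} \<in> edges S32 \<longleftrightarrow> {\<phi> x, \<phi> y} \<in> edges ?C"
    unfolding graph_isomorphic_def by blast
  have inj: "\<phi> x \<noteq> \<phi> y" if "x \<in> {0, 1, 2, 3, 4, 5, 6}" "y \<in> {0, 1, 2, 3, 4, 5, 6}" "x \<noteq> y" for x y
    using bij_betw_imp_inj_on[OF \<phi>(1)] that unfolding S32_sel by (meson inj_onD)
  have E: "{\<phi> 0, \<phi> 1} \<in> edges ?C" "{\<phi> 0, \<phi> 2} \<in> edges ?C" "{\<phi> 0, \<phi> 3} \<in> edges ?C"
    "{\<phi> 1, \<phi> 4} \<in> edges ?C" "{\<phi> 2, \<phi> 5} \<in> edges ?C" "{\<phi> 3, \<phi> 6} \<in> edges ?C"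
    using \<phi>(2)[of 0 1] \<phi>(2)[of 0 2] \<phi>(2)[of 0 3] \<phi>(2)[of 1 4] \<phi>(2)[of 2 5] \<phi>(2)[of 3 6]
    by (simp_all add: S32_sel)
  have spine: "snd (\<phi> x) = 0"
    if "{\<phi> x, \<phi> y} \<in> edges ?C" "{\<phi> x, \<phi> z} \<in> edges ?C" "\<phi> y \<noteq> \<phi> z" for x y z
  proof (rule ccontr)
    assume "snd (\<phi> x) \<noteq> 0"
    then have "\<phi> y = (fst (\<phi> x), 0)" "\<phi> z = (fst (\<phi> x), 0)"
      using caterpillar_tree_adjacent(1)[of "fst (\<phi> x)" "snd (\<phi> x)" _ _ a] that(1,2)
      by (cases "\<phi> x"; cases "\<phi> y"; cases "\<phi> z"; simp)+
    with that(3) show False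
      by simp
  qed
  have s: "snd (\<phi> 0) = 0" "snd (\<phi> 1) = 0" "snd (\<phi> 2) = 0" "snd (\<phi> 3) = 0"
    using spine[of 0 1 2] spine[of 1 0 4] spine[of 2 0 5] spine[of 3 0 6] E inj
    by (simp_all add: insert_commute)
  have near: "fst (\<phi> x) = Suc (fst (\<phi> 0)) \<or> fst (\<phi> 0) = Suc (fst (\<phi> x))" if "x \<in> {1, 2, 3}" for x
    using that E s caterpillar_tree_adjacent(2)[of "fst (\<phi> 0)" 0 "fst (\<phi> x)" 0 a]
    by (metis insertE prod.collapse singletonD)
  have "fst (\<phi> 1) \<noteq> fst (\<phi> 2)" "fst (\<phi> 1) \<noteq> fst (\<phi> 3)" "fst (\<phi> 2) \<noteq> fst (\<phi> 3)"
    using inj[of 1 2] inj[of 1 3] inj[of 2 3] s by (auto simp: prod_eq_iff)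
  with near[of 1] near[of 2] near[of 3] show False
    by auto
qed

lemma S32_pos_ricci_null: "\<exists>x. pos_ricci_null S32 x"
proof -
  \<comment> \<open>With these values every edge receives 1 from its endpoint nearer to the centre
    and -1 from the other one.\<close>
  define x :: "nat set \<Rightarrow> real" where "x e = (if 0 \<in> e then 3 else 1)" for e
  have star: "star_sum S32 y z = (\<Sum>f\<in>edges S32. if z \<in> f then y f else 0)" for y z
    unfolding star_sum_def by (rule sum.inter_filter) (simp add: S32_sel)
  have edges: "sum g (edges S32) = g {0, 1} + g {0, 2} + g {0, 3} + g {1, 4} + g {2, 5} + g {3, 6}" for g :: "nat set \<Rightarrow> real"
    by (simp add: S32_sel doubleton_eq_iff add.assoc)
  have "pos_ricci_null S32 x"
    unfolding pos_ricci_null_def vertex_degree_eq_star_sum star edges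
    by (simp add: S32_sel x_def)
  then show ?thesis
    by blast
qed

section \<open>Copies of \<open>S32\<close> inside a tree\<close>

lemma tree_no_triangle:
  assumes T: "is_tree T" and "a \<noteq> b" "b \<noteq> c" "a \<noteq> c"
    and "{a, b} \<in> edges T" "{b, c} \<in> edges T" "{c, a} \<in> edges T"
  shows False
proof -
  have "is_cycle T [a, b, c]"
    using assms(2-) by (auto simp: is_cycle_def less_Suc_eq)
  then show False
    using is_treeD(6)[OF T] by blast
qed

lemma tree_no_square:
  assumes T: "is_tree T" and "distinct [a, b, c, d]"
    and "{a, b} \<in> edges T" "{b, c} \<in> edges T" "{c, d} \<in> edges T" "{d, a} \<in> edges T"
  shows False
proof -
  have "is_cycle T [a, b, c, d]"
    using assms(2-) by (auto simp: is_cycle_def less_Suc_eq)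
  then show False
    using is_treeD(6)[OF T] by blast
qed

text \<open>The seven vertices are distinct because a coincidence between different branches would
  close a triangle or a square through \<open>v\<close>.\<close>

lemma S32_subtree_if_three_branches:
  assumes T: "is_tree T" and w: "{v, w1} \<in> edges T" "{v, w2} \<in> edges T" "{v, w3} \<in> edges T"
    and wd: "distinct [w1, w2, w3]"
    and z: "{w1, z1} \<in> edges T" "{w2, z2} \<in> edges T" "{w3, z3} \<in> edges T"
    and zv: "z1 \<noteq> v" "z2 \<noteq> v" "z3 \<noteq> v"
  shows "\<exists>H. is_tree H \<and> subgraph_of H T \<and> graph_isomorphic H S32"
proof -
  note edgeD = simple_graph_edgeD[OF is_treeD(1)[OF T]]
  have zw: "p \<noteq> y" if "{v, x} \<in> edges T" "{v, y} \<in> edges T" "x \<noteq> y" "{x, p} \<in> edges T" for x y p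
    using tree_no_triangle[OF T, of v x y] that edgeD(1) by (auto simp: insert_commute)
  have zz: "p \<noteq> q" if "{v, x} \<in> edges T" "{v, y} \<in> edges T" "x \<noteq> y" "{x, p} \<in> edges T" "{y, q} \<in> edges T" "p \<noteq> v" for x y p q
    using tree_no_square[OF T, of v x p y] that edgeD(1) by (auto simp: insert_commute)
  define xs where "xs = [v, w1, w2, w3, z1, z2, z3]"
  have dist: "distinct xs"
  proof -
    have "w1 \<noteq> w2" "w1 \<noteq> w3" "w2 \<noteq> w3"
      using wd by simp_all
    moreover from this have "z1 \<noteq> w2" "z1 \<noteq> w3" "z2 \<noteq> w1" "z2 \<noteq> w3" "z3 \<noteq> w1" "z3 \<noteq> w2"
      using zw[OF w(1,2) _ z(1)] zw[OF w(1,3) _ z(1)] zw[OF w(2,1) _ z(2)] zw[OF w(2,3) _ z(2)]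
        zw[OF w(3,1) _ z(3)] zw[OF w(3,2) _ z(3)] by metis+
    moreover have "z1 \<noteq> z2" "z1 \<noteq> z3" "z2 \<noteq> z3"
      using wd zz[OF w(1,2) _ z(1,2) zv(1)] zz[OF w(1,3) _ z(1,3) zv(1)] zz[OF w(2,3) _ z(2,3) zv(2)]
      by simp_all
    moreover note edgeD(1)[OF w(1)] edgeD(1)[OF w(2)] edgeD(1)[OF w(3)]
      edgeD(1)[OF z(1)] edgeD(1)[OF z(2)] edgeD(1)[OF z(3)]
    ultimately show ?thesis
      using zv by (simp add: xs_def eq_commute)
  qed
  let ?\<psi> = "\<lambda>i. xs ! i"
  define H where "H = Graph (?\<psi> ` verts S32) ((`) ?\<psi> ` edges S32)"
  have VH: "verts H = {v, w1, w2, w3, z1, z2, z3}"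
    and EH: "edges H = {{v, w1}, {v, w2}, {v, w3}, {w1, z1}, {w2, z2}, {w3, z3}}"
    by (simp_all add: H_def S32_sel xs_def)
  have inj: "inj_on ?\<psi> (verts S32)"
    using dist by (intro inj_on_nth) (auto simp: S32_sel xs_def)
  have sub: "subgraph_of H T"
    unfolding subgraph_of_def VH EH using w z edgeD by blast
  have simpH: "simple_graph H"
    unfolding simple_graph_def VH EH using w z edgeD(1) by (auto simp: card_insert_if)
  have "graph_connected H"
  proof (rule graph_connectedI[of v])
    let ?R = "\<lambda>x y. {x, y} \<in> edges H"
    have one: "?R\<^sup>*\<^sup>* v w1" "?R\<^sup>*\<^sup>* v w2" "?R\<^sup>*\<^sup>* v w3"
      by (auto simp: EH intro!: r_into_rtranclp)
    have "?R w1 z1" "?R w2 z2" "?R w3 z3"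
      by (simp_all add: EH)
    then have "?R\<^sup>*\<^sup>* v z1" "?R\<^sup>*\<^sup>* v z2" "?R\<^sup>*\<^sup>* v z3"
      using one by (auto intro: rtranclp.rtrancl_into_rtrancl)
    with one show "?R\<^sup>*\<^sup>* v x" if "x \<in> verts H" for x
      using that unfolding VH by blast
  qed (simp add: VH)
  then have "is_tree H"
    using simpH is_cycle_subgraph[OF sub] is_treeD(6)[OF T]
    by (auto simp: is_tree_def VH EH)
  moreover have "graph_isomorphic S32 H"
    by (rule graph_isomorphicI[of _ ?\<psi>]) (use inj in \<open>auto simp: simple_S32 H_def bij_betw_def\<close>)
  ultimately show ?thesis
    using sub graph_isomorphic_sym by blast
qed

section \<open>Recognizing caterpillars\<close>

lemma caterpillar_if_dominating_path:
  assumes T: "is_tree T" and p: "graph_path T p" "set p \<subseteq> verts T"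
    and leaf: "\<And>i u x. i < length p \<Longrightarrow> u \<notin> set p \<Longrightarrow> {p ! i, u} \<in> edges T \<Longrightarrow> {u, x} \<in> edges T \<Longrightarrow> x = p ! i"
    and ends: "\<exists>u. u \<notin> set p \<and> {hd p, u} \<in> edges T" "\<exists>u. u \<notin> set p \<and> {last p, u} \<in> edges T"
  shows "is_caterpillar T"
proof -
  note edgeD = simple_graph_edgeD[OF is_treeD(1)[OF T]]
  \<comment> \<open>\<open>A i\<close> collects the leaves hanging off the spine vertex
    \<open>p ! i\<close>; it is enumerated from 1 to match the leaf labels of
    \<open>caterpillar_tree\<close>, where 0 marks the spine.\<close>
  define A where "A i = {u. u \<notin> set p \<and> {p ! i, u} \<in> edges T}" for i
  have finA: "finite (A i)" for i
    by (rule finite_subset[OF _ is_treeD(2)[OF T]]) (use edgeD in \<open>auto simp: A_def\<close>)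
  then have "\<exists>h. bij_betw h {1..card (A i)} (A i)" for i
    by (rule ex_bij_betw_nat_finite_1)
  then obtain h where h: "\<And>i. bij_betw (h i) {1..card (A i)} (A i)"
    by metis
  define a where "a = map (\<lambda>i. card (A i)) [0..<length p]"
  have len: "length a = length p" and a: "\<And>i. i < length p \<Longrightarrow> a ! i = card (A i)"
    by (simp_all add: a_def)
  have p_ne: "p \<noteq> []" and p_dist: "distinct p"
    using p(1) by (auto simp: graph_path_def)
  let ?C = "caterpillar_tree a"
  define \<psi> where "\<psi> = (\<lambda>(i, j). if j = 0 then p ! i else h i j)"
  have \<psi>: "\<psi> (i, 0) = p ! i" "j \<ge> 1 \<Longrightarrow> \<psi> (i, j) = h i j" for i j
    by (auto simp: \<psi>_def)
  have h_img: "h i ` {1..card (A i)} = A i" for i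
    using h[of i] by (simp add: bij_betw_def)
  have hA: "h i j \<in> A i" if "1 \<le> j" "j \<le> card (A i)" for i j
    using h_img[of i] that by auto
  have h_surj: "\<exists>j. 1 \<le> j \<and> j \<le> card (A i) \<and> u = h i j" if "u \<in> A i" for i u
  proof -
    have "u \<in> h i ` {1..card (A i)}"
      using that by (simp only: h_img)
    then show ?thesis
      by auto
  qed
  have S: "verts T \<subseteq> set p \<union> (\<Union>i<length p. A i)"
  proof (rule connected_closed_set[OF is_treeD(5)[OF T], of "hd p"])
    fix u v assume uv: "u \<in> set p \<union> (\<Union>i<length p. A i)" "{u, v} \<in> edges T"
    show "v \<in> set p \<union> (\<Union>i<length p. A i)"
    proof (cases "u \<in> set p")
      case True
      then obtain i where "i < length p" "u = p ! i"
        by (auto simp: in_set_conv_nth)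
      with uv show ?thesis
        by (auto simp: A_def)
    next
      case False
      then obtain i where i: "i < length p" "u \<in> A i"
        using uv by blast
      then have "v = p ! i"
        using leaf[of i u v] uv(2) by (auto simp: A_def)
      with i show ?thesis
        by simp
    qed
  qed (use p p_ne in auto)
  have A_unique: "i = i'" if "u \<in> A i" "u \<in> A i'" "i < length p" "i' < length p" for i i' u
    using tree_path_unique_attachment[OF T p(1), of u i i'] that by (auto simp: A_def)
  have C_cases: "x \<in> verts ?C \<longleftrightarrow> (\<exists>i<length p. x = (i, 0) \<or> (\<exists>j. x = (i, j) \<and> 1 \<le> j \<and> j \<le> card (A i)))" for x
  proof -
    have "x \<in> verts ?C \<longleftrightarrow> fst x < length p \<and> snd x \<le> card (A (fst x))"
      using a by (cases x) (auto simp: caterpillar_tree_sel len)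
    then show ?thesis
      by (cases x; cases "snd x") auto
  qed
  have "inj_on \<psi> (verts ?C)"
  proof (rule inj_onI)
    fix x y assume x: "x \<in> verts ?C" and y: "y \<in> verts ?C" and eq: "\<psi> x = \<psi> y"
    obtain i j i' j' where ij: "x = (i, j)" "y = (i', j')"
      by (cases x; cases y)
    have b: "i < length p" "j \<le> card (A i)" "i' < length p" "j' \<le> card (A i')"
      using x y a unfolding ij by (auto simp: caterpillar_tree_sel len)
    have off: "h k l \<notin> set p" if "l \<noteq> 0" "l \<le> card (A k)" for k l
      using hA[of l k] that by (auto simp: A_def)
    consider "j = 0" "j' = 0" | "j = 0" "j' \<noteq> 0" | "j \<noteq> 0" "j' = 0" | "j \<noteq> 0" "j' \<noteq> 0"
      by blast
    then show "x = y"
    proof cases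
      case 1
      then show ?thesis
        using eq b p_dist by (simp add: ij \<psi>_def nth_eq_iff_index_eq)
    next
      case 2
      then have "p ! i = h i' j'"
        using eq by (simp add: ij \<psi>_def)
      then show ?thesis
        using off[OF 2(2) b(4)] b(1) by (metis nth_mem)
    next
      case 3
      then have "h i j = p ! i'"
        using eq by (simp add: ij \<psi>_def)
      then show ?thesis
        using off[OF 3(1) b(2)] b(3) by (metis nth_mem)
    next
      case 4
      then have e: "h i j = h i' j'"
        using eq by (simp add: ij \<psi>_def)
      have "h i j \<in> A i" "h i' j' \<in> A i'"
        using 4 b by (auto intro!: hA)
      then have "i = i'"
        using A_unique[of "h i j" i i'] b e by simp
      moreover have "j = j'"
      proof (rule inj_onD[OF bij_betw_imp_inj_on[OF h[of i]]])
        show "h i j = h i j'"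
          using e \<open>i = i'\<close> by simp
      qed (use 4 b \<open>i = i'\<close> in auto)
      ultimately show ?thesis
        by (simp add: ij)
    qed
  qed
  moreover have "\<psi> ` verts ?C = verts T"
  proof (intro equalityI subsetI)
    fix u assume "u \<in> \<psi> ` verts ?C"
    then obtain i j where ij: "i < length p" "j \<le> card (A i)" "u = \<psi> (i, j)"
      using a by (auto simp: caterpillar_tree_sel len)
    show "u \<in> verts T"
    proof (cases "j = 0")
      case True
      with ij p(2) show ?thesis
        by (auto simp: \<psi>)
    next
      case False
      then have "u \<in> A i"
        using ij hA[of j i] by (simp add: \<psi>_def)
      then show ?thesis
        using edgeD by (auto simp: A_def)
    qed
  next
    fix u assume "u \<in> verts T"
    with S have "u \<in> set p \<union> (\<Union>i<length p. A i)"
      by blast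
    then consider i where "i < length p" "u = p ! i" | i where "i < length p" "u \<in> A i"
      by (auto simp: in_set_conv_nth)
    then show "u \<in> \<psi> ` verts ?C"
    proof cases
      case 1
      then show ?thesis
        by (intro image_eqI[of _ _ "(i, 0)"]) (auto simp: \<psi> caterpillar_tree_sel len)
    next
      case 2
      then obtain j where "1 \<le> j" "j \<le> card (A i)" "u = h i j"
        using h_surj by blast
      with 2 a show ?thesis
        by (intro image_eqI[of _ _ "(i, j)"]) (auto simp: \<psi> caterpillar_tree_sel len)
    qed
  qed
  ultimately have bij: "bij_betw \<psi> (verts ?C) (verts T)"
    by (simp add: bij_betw_def)
  have spine_edge: "{p ! i, p ! Suc i} \<in> (`) \<psi> ` edges ?C" if "Suc i < length p" for i
    using that by (intro image_eqI[of _ _ "{(i, 0), (Suc i, 0)}"]) (auto simp: \<psi> caterpillar_tree_sel len)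
  have leaf_edge: "{p ! i, u} \<in> (`) \<psi> ` edges ?C" if i: "i < length p" and u: "u \<in> A i" for i u
  proof -
    obtain j where j: "1 \<le> j" "j \<le> card (A i)" "u = h i j"
      using h_surj[OF u] by blast
    have "{(i, 0), (i, j)} \<in> edges ?C"
      using i j a by (auto simp: caterpillar_tree_sel len)
    then show ?thesis
      using j by (intro image_eqI[of _ _ "{(i, 0), (i, j)}"]) (auto simp: \<psi>)
  qed
  have "edges T = (`) \<psi> ` edges ?C"
  proof (intro equalityI subsetI)
    fix e assume e: "e \<in> edges T"
    have main: "{u, v} \<in> (`) \<psi> ` edges ?C" if uv: "{u, v} \<in> edges T" "u \<in> set p" for u v
    proof -
      obtain i where i: "i < length p" "u = p ! i"
        using uv by (auto simp: in_set_conv_nth)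
      show ?thesis
      proof (cases "v \<in> set p")
        case True
        then obtain j where j: "j < length p" "v = p ! j"
          by (auto simp: in_set_conv_nth)
        consider "i < j" | "j < i" | "i = j"
          by linarith
        then show ?thesis
        proof cases
          case 1
          then have "j = Suc i"
            using tree_path_edge[OF T p(1) 1] i j uv by simp
          then show ?thesis
            using spine_edge[of i] i j by simp
        next
          case 2
          then have "i = Suc j"
            using tree_path_edge[OF T p(1) 2] i j uv by (simp add: insert_commute)
          then show ?thesis
            using spine_edge[of j] i j by (simp add: insert_commute)
        next
          case 3
          then show ?thesis
            using edgeD(1)[OF uv(1)] i j by simp
        qed
      next
        case False
        then show ?thesis
          using leaf_edge[of i v] i uv by (simp add: A_def)
      qed
    qed
    obtain u v where uv: "e = {u, v}" "u \<in> verts T"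
      using simple_graphE[OF is_treeD(1)[OF T] e] by metis
    show "e \<in> (`) \<psi> ` edges ?C"
    proof (cases "u \<in> set p")
      case True
      then show ?thesis
        using main e uv by simp
    next
      case False
      then obtain i where i: "i < length p" "u \<in> A i"
        using S uv by blast
      then have "v = p ! i"
        using leaf[of i u v] e uv by (auto simp: A_def)
      then show ?thesis
        using main[of v u] e i uv by (simp add: insert_commute)
    qed
  next
    fix e assume "e \<in> (`) \<psi> ` edges ?C"
    then consider i where "Suc i < length p" "e = {p ! i, p ! Suc i}"
      | i j where "i < length p" "1 \<le> j" "j \<le> card (A i)" "e = {p ! i, h i j}"
      using a by (auto simp: caterpillar_tree_sel len \<psi>)
    then show "e \<in> edges T"
    proof cases
      case 1
      then show ?thesis
        using p(1) by (simp add: graph_path_def)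
    next
      case 2
      then show ?thesis
        using hA[of j i] by (simp add: A_def)
    qed
  qed
  then have "graph_isomorphic ?C T"
    by (intro graph_isomorphicI[OF simple_caterpillar_tree bij])
  then have "graph_isomorphic T ?C"
    by (rule graph_isomorphic_sym)
  moreover have "hd a \<ge> 1" "last a \<ge> 1"
  proof -
    have "A 0 \<noteq> {}" "A (length p - 1) \<noteq> {}"
      using ends p_ne by (auto simp: A_def hd_conv_nth last_conv_nth)
    then have "card (A 0) > 0" "card (A (length p - 1)) > 0"
      using finA by (auto simp: card_gt_0_iff)
    moreover have "a \<noteq> []"
      using p_ne len by auto
    ultimately show "hd a \<ge> 1" "last a \<ge> 1"
      using p_ne a[of 0] a[of "length p - 1"] by (simp_all add: hd_conv_nth last_conv_nth len)
  qed
  moreover have "a \<noteq> []"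
    using p_ne len by auto
  ultimately show ?thesis
    using T by (auto simp: is_caterpillar_def)
qed

text \<open>\<open>N\<close> is the set of vertices that are not leaves, and a longest path inside
  \<open>N\<close> serves as the spine. A neighbour off this path lies outside \<open>N\<close>: at
  an end by maximality, at an inner vertex because three neighbours in \<open>N\<close> are
  excluded.\<close>

lemma caterpillar_or_three_branches:
  assumes T: "is_tree T"
  defines "N \<equiv> {w. \<exists>x y. x \<noteq> y \<and> {w, x} \<in> edges T \<and> {w, y} \<in> edges T}"
  assumes few: "\<And>v w1 w2 w3. {v, w1} \<in> edges T \<Longrightarrow> {v, w2} \<in> edges T \<Longrightarrow> {v, w3} \<in> edges T \<Longrightarrow>
    distinct [w1, w2, w3] \<Longrightarrow> {w1, w2, w3} \<subseteq> N \<Longrightarrow> False"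
  shows "is_caterpillar T"
proof (cases "N = {}")
  case True
  \<comment> \<open>Here \<open>T\<close> is a single edge, and one of its two vertices is taken as
    the spine.\<close>
  obtain e where "e \<in> edges T"
    using is_treeD(4)[OF T] by blast
  then obtain u v where uv: "{u, v} \<in> edges T" "u \<noteq> v" "u \<in> verts T"
    using simple_graphE[OF is_treeD(1)[OF T]] by metis
  show ?thesis
  proof (rule caterpillar_if_dominating_path[OF T, of "[u]"])
    fix i y x assume "i < length [u]" "{[u] ! i, y} \<in> edges T" and yx: "{y, x} \<in> edges T"
    then have i: "i = 0" and "{y, u} \<in> edges T"
      by (simp_all add: insert_commute)
    with True yx have "x = u"
      unfolding N_def by blast
    with i show "x = [u] ! i"
      by simp
  qed (use uv in auto)
next
  case False
  note edgeD = simple_graph_edgeD[OF is_treeD(1)[OF T]]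
  have NV: "N \<subseteq> verts T"
    using edgeD(2) by (auto simp: N_def)
  then obtain w where w: "w \<in> N"
    using False by blast
  let ?P = "\<lambda>p. graph_path T p \<and> set p \<subseteq> N"
  have "length q < Suc (card (verts T))" if "?P q" for q
  proof -
    have "length q = card (set q)"
      using that by (simp add: graph_path_def distinct_card)
    also have "\<dots> \<le> card (verts T)"
      using that NV is_treeD(2)[OF T] by (intro card_mono) auto
    finally show ?thesis
      by simp
  qed
  then obtain p where p: "graph_path T p" "set p \<subseteq> N" and longest: "\<And>q. ?P q \<Longrightarrow> length q \<le> length p"
    using ex_has_greatest_nat[of ?P "[w]" length "Suc (card (verts T))"] w by auto
  have p_ne: "p \<noteq> []"
    using p by (auto simp: graph_path_def)
  have rev_p: "graph_path T (rev p)" "set (rev p) \<subseteq> N"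
    using graph_path_rev[OF p(1)] p(2) by auto
  have hd_off: "u \<notin> N" if q: "graph_path T q" "set q \<subseteq> N" "length q = length p"
    and u: "u \<notin> set q" "{hd q, u} \<in> edges T" for q u
  proof
    assume "u \<in> N"
    then have "?P (u # q)"
      using q u by (auto intro!: graph_path_Cons simp: insert_commute)
    from longest[OF this] q(3) show False
      by simp
  qed
  have off: "u \<notin> N" if i: "i < length p" and u: "u \<notin> set p" "{p ! i, u} \<in> edges T" for i u
  proof -
    consider "i = 0" | "i = length p - 1" | "0 < i" "Suc i < length p"
      using i by linarith
    then show ?thesis
    proof cases
      case 1
      then show ?thesis
        using hd_off[OF p refl u(1)] u p_ne by (simp add: hd_conv_nth)
    next
      case 2
      then show ?thesis
        using hd_off[OF rev_p, of u] u p_ne by (simp add: hd_rev last_conv_nth)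
    next
      case 3
      then obtain k where k: "i = Suc k"
        by (cases i) auto
      have "{p ! i, p ! k} \<in> edges T" "{p ! i, p ! Suc i} \<in> edges T"
        using p(1) 3 k by (auto simp: graph_path_def insert_commute)
      moreover have "distinct [p ! k, p ! Suc i, u]"
        using u(1) p(1) 3 k by (auto simp: graph_path_def nth_eq_iff_index_eq)
      moreover have "p ! k \<in> N" "p ! Suc i \<in> N"
        using p(2) 3 k by auto
      ultimately show ?thesis
        using few[of "p ! i" "p ! k" "p ! Suc i" u] u(2) by auto
    qed
  qed
  \<comment> \<open>An end of the path has two neighbours, and only the next path vertex can lie on
    the path, so one neighbour is off it.\<close>
  have hd_leaf: "\<exists>u. u \<notin> set q \<and> {hd q, u} \<in> edges T" if q: "graph_path T q" "set q \<subseteq> N" for q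
  proof -
    have q_ne: "q \<noteq> []"
      using q by (auto simp: graph_path_def)
    then obtain x y where xy: "x \<noteq> y" "{hd q, x} \<in> edges T" "{hd q, y} \<in> edges T"
      using q(2) hd_in_set[OF q_ne] unfolding N_def by blast
    have "z = q ! 1" if z: "z \<in> set q" "{hd q, z} \<in> edges T" for z
    proof -
      obtain j where j: "j < length q" "z = q ! j"
        using z by (auto simp: in_set_conv_nth)
      moreover have "j \<noteq> 0"
        using edgeD(1)[OF z(2)] j q_ne by (cases j) (auto simp: hd_conv_nth)
      ultimately show ?thesis
        using tree_path_edge[OF T q(1), of 0 j] z(2) q_ne by (simp add: hd_conv_nth)
    qed
    with xy show ?thesis
      by metis
  qed
  show ?thesis
  proof (rule caterpillar_if_dominating_path[OF T p(1)])
    show "set p \<subseteq> verts T"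
      using p(2) NV by blast
    show "\<exists>u. u \<notin> set p \<and> {hd p, u} \<in> edges T"
      by (rule hd_leaf[OF p])
    show "\<exists>u. u \<notin> set p \<and> {last p, u} \<in> edges T"
      using hd_leaf[OF rev_p] p_ne by (simp add: hd_rev)
  next
    fix i u x assume *: "i < length p" "u \<notin> set p" "{p ! i, u} \<in> edges T" "{u, x} \<in> edges T"
    then have "u \<notin> N"
      using off by blast
    moreover have "{u, p ! i} \<in> edges T"
      using * by (simp add: insert_commute)
    ultimately show "x = p ! i"
      using *(4) unfolding N_def by blast
  qed
qed

lemma non_caterpillar_contains_S32:
  assumes T: "is_tree T" and "\<not> is_caterpillar T"
  shows "\<exists>H. is_tree H \<and> subgraph_of H T \<and> graph_isomorphic H S32"
proof (rule ccontr)
  assume none: "\<not> ?thesis"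
  have "is_caterpillar T"
  proof (rule caterpillar_or_three_branches[OF T])
    fix v w1 w2 w3
    assume w: "{v, w1} \<in> edges T" "{v, w2} \<in> edges T" "{v, w3} \<in> edges T" "distinct [w1, w2, w3]"
      and N: "{w1, w2, w3} \<subseteq> {w. \<exists>x y. x \<noteq> y \<and> {w, x} \<in> edges T \<and> {w, y} \<in> edges T}"
    have branch: "\<exists>z. z \<noteq> v \<and> {w, z} \<in> edges T" if "w \<in> {w1, w2, w3}" for w
    proof -
      from subsetD[OF N that] obtain x y where "x \<noteq> y" "{w, x} \<in> edges T" "{w, y} \<in> edges T"
        by auto
      then show ?thesis
        by (cases "x = v") auto
    qed
    obtain z1 where z1: "z1 \<noteq> v" "{w1, z1} \<in> edges T"
      using branch[of w1] by auto
    obtain z2 where z2: "z2 \<noteq> v" "{w2, z2} \<in> edges T"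
      using branch[of w2] by auto
    obtain z3 where z3: "z3 \<noteq> v" "{w3, z3} \<in> edges T"
      using branch[of w3] by auto
    show False
      using S32_subtree_if_three_branches[OF T w z1(2) z2(2) z3(2) z1(1) z2(1) z3(1)] none by contradiction
  qed
  with assms(2) show False ..
qed

lemma S32_pos_ricci_null_isomorphic:
  assumes "simple_graph T" "graph_isomorphic T S32"
  shows "\<exists>x. pos_ricci_null T x"
  using S32_pos_ricci_null pos_ricci_null_isomorphic[OF assms(1) simple_S32 assms(2)] by blast

lemma ricci_lambda_max_pos_if_properly_contains_S32:
  assumes "is_tree T" "properly_contains T S32"
  shows "ricci_lambda_max T > 0"
  using assms S32_pos_ricci_null_isomorphic ricci_lambda_max_pos_if_null_proper_subtree is_treeD(1)
  unfolding properly_contains_def by metis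

lemma listed_caterpillar:
  assumes "(\<exists>m\<ge>2. a = [3] @ replicate (m - 2) 0 @ [3]) \<or> a \<in> sporadic_sequences \<or> rev a \<in> sporadic_sequences"
  shows "length a \<ge> 2 \<and> hd a \<ge> 1 \<and> last a \<ge> 1 \<and> (\<exists>x. pos_ricci_null (caterpillar_tree a) x)"
proof -
  have spor: "length b \<ge> 2 \<and> hd b \<ge> 1 \<and> last b \<ge> 1" if "b \<in> sporadic_sequences" for b
    using that unfolding sporadic_sequences_def by (elim insertE emptyE) simp_all
  have "length a \<ge> 2 \<and> hd a \<ge> 1 \<and> last a \<ge> 1"
    using assms
  proof (elim disjE exE conjE)
    assume "rev a \<in> sporadic_sequences"
    from spor[OF this] show ?thesis
      by (cases "a = []") (auto simp: hd_rev last_rev)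
  qed (use spor in auto)
  moreover have "\<exists>s. spine_null (length a) (\<lambda>i. a ! i) s"
    using assms constant_spine_null sporadic_spine_null spine_null_rev_list by metis
  ultimately show ?thesis
    using caterpillar_null_if_spine_null by blast
qed

theorem theorem2p2:
  "(\<forall>T :: 'a graph. is_tree T \<longrightarrow>
      (\<not> is_caterpillar T \<and> ricci_lambda_max T = 0 \<longleftrightarrow> graph_isomorphic T S32)) \<and>
   (\<forall>T :: 'a graph. is_tree T \<and> properly_contains T S32 \<longrightarrow> ricci_lambda_max T > 0) \<and>
   (\<forall>T :: 'a graph. is_tree T \<longrightarrow>
      (is_caterpillar T \<and> ricci_lambda_max T = 0 \<longleftrightarrow>
        (\<exists>m\<ge>2. graph_isomorphic T (caterpillar_tree ([3] @ replicate (m - 2) 0 @ [3]))) \<or>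
        (\<exists>a. (a \<in> sporadic_sequences \<or> rev a \<in> sporadic_sequences) \<and>
             graph_isomorphic T (caterpillar_tree a))))"
proof (intro conjI allI impI)
  fix T :: "'a graph" assume T: "is_tree T"
  note null_0 = ricci_lambda_max_eq_0_if_null[OF is_treeD(1,3,4)[OF T]]
  show "\<not> is_caterpillar T \<and> ricci_lambda_max T = 0 \<longleftrightarrow> graph_isomorphic T S32"
  proof (intro iffI conjI)
    assume nc: "\<not> is_caterpillar T \<and> ricci_lambda_max T = 0"
    then obtain H where H: "is_tree H" "subgraph_of H T" "graph_isomorphic H S32"
      using non_caterpillar_contains_S32[OF T] by blast
    \<comment> \<open>Were \<open>H\<close> a proper subtree, its positive null vector would make
      the largest eigenvalue of \<open>T\<close> positive.\<close>
    then have "H = T"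
      using ricci_lambda_max_pos_if_properly_contains_S32[OF T] nc by (force simp: properly_contains_def)
    with H show "graph_isomorphic T S32"
      by simp
  next
    assume iso: "graph_isomorphic T S32"
    show "\<not> is_caterpillar T"
      using graph_isomorphic_trans[OF graph_isomorphic_sym[OF iso]] S32_not_isomorphic_caterpillar
      by (auto simp: is_caterpillar_def)
    show "ricci_lambda_max T = 0"
      using S32_pos_ricci_null_isomorphic[OF is_treeD(1)[OF T] iso] null_0 by blast
  qed
  show "is_caterpillar T \<and> ricci_lambda_max T = 0 \<longleftrightarrow>
        (\<exists>m\<ge>2. graph_isomorphic T (caterpillar_tree ([3] @ replicate (m - 2) 0 @ [3]))) \<or>
        (\<exists>a. (a \<in> sporadic_sequences \<or> rev a \<in> sporadic_sequences) \<and>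
             graph_isomorphic T (caterpillar_tree a))" (is "?L \<longleftrightarrow> ?R")
  proof
    assume ?L
    then obtain a where a: "a \<noteq> []" "hd a \<ge> 1" "last a \<ge> 1" and iso: "graph_isomorphic T (caterpillar_tree a)"
      by (auto simp: is_caterpillar_def)
    obtain x where x: "pos_ricci_null (caterpillar_tree a) x"
      using pos_null_vector_exists_if_ricci_lambda_max_eq_0[OF T] \<open>?L\<close>
        pos_ricci_null_isomorphic[OF simple_caterpillar_tree is_treeD(1)[OF T] graph_isomorphic_sym[OF iso]]
      by blast
    have m: "length a \<ge> 2"
    proof (rule ccontr)
      assume "\<not> length a \<ge> 2"
      then obtain n where "a = [n]"
        using a(1) by (cases a rule: remdups_adj.cases) auto
      then show False
        using star_no_ricci_null[of n x] x a by simp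
    qed
    show ?R
      using spine_null_classification[OF m a(2,3) caterpillar_spine_null[OF m x]] iso by blast
  next
    assume ?R
    then obtain a where "(\<exists>m\<ge>2. a = [3] @ replicate (m - 2) 0 @ [3]) \<or> a \<in> sporadic_sequences \<or> rev a \<in> sporadic_sequences"
      and iso: "graph_isomorphic T (caterpillar_tree a)"
      by blast
    then have a: "length a \<ge> 2" "hd a \<ge> 1" "last a \<ge> 1" "\<exists>x. pos_ricci_null (caterpillar_tree a) x"
      using listed_caterpillar by blast+
    then have "\<exists>x. pos_ricci_null T x"
      using pos_ricci_null_isomorphic[OF is_treeD(1)[OF T] simple_caterpillar_tree iso] by blast
    moreover have "a \<noteq> []"
      using a(1) by auto
    ultimately show ?L
      using T a iso null_0 by (auto simp: is_caterpillar_def)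
  qed
next
  fix T :: "'a graph" assume "is_tree T \<and> properly_contains T S32"
  then show "ricci_lambda_max T > 0"
    using ricci_lambda_max_pos_if_properly_contains_S32 by blast
qed

end
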